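(* Let $H,W\ge 2$ be integers and let $\Omega=[-1,1]\times[-1,1]\subset\mathbb{R}^2\cong\mathbb{C}$, triangulated by taking the regular grid of vertices $\{(\tfrac{2i}{H-1}-1,\tfrac{2j}{W-1}-1): 0\le i\le H-1,\ 0\le j\le W-1\}$ and dividing each small grid rectangle into two triangles by a diagonal. Let $\tilde f:\Omega\to\Omega$ be a mapping output by the Beltrami Adjustment Module, that is, a continuous map which is affine on every triangular face $T$ of this triangulation and satisfies $\tilde f(x)=x$ for every $x\in\partial\Omega$. Let $\tilde\mu$ be the Beltrami coefficient associated with $\tilde f$, so that on each triangular face $T$ $$\tilde\mu(T)=\frac{\partial \tilde f}{\partial\bar z}(T)\Big/\frac{\partial\tilde f}{\partial z}(T).$$ Then $\tilde f$ is bijective if and only if $\tilde\mu$ is well-defined (i.e. $\frac{\partial\tilde f}{\partial z}(T)\neq 0$ for every triangular face $T$) and satisfies $|\tilde\mu(T)|<1$ for all triangular faces $T$.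
   Context: Identify $\mathbb{R}^2$ with $\mathbb{C}$ via $z=x+iy$, and write $\frac{\partial}{\partial z}=\frac12\left(\frac{\partial}{\partial x}-i\frac{\partial}{\partial y}\right)$ and $\frac{\partial}{\partial\bar z}=\frac12\left(\frac{\partial}{\partial x}+i\frac{\partial}{\partial y}\right)$. A map $\tilde f$ that is affine on a triangular face $T$ has the form $\tilde f(x,y)=(a^x_1x+a^x_2y+b^x)+i(a^y_1x+a^y_2y+b^y)$ on $T$ with real constants depending on $T$. Its first derivatives are therefore constant on $T$, and $\frac{\partial\tilde f}{\partial z}(T)$, $\frac{\partial\tilde f}{\partial\bar z}(T)$ denote these constant values. Explicitly, $\frac{\partial\tilde f}{\partial z}(T)=\frac12\left[(a^x_1+a^y_2)+i(a^y_1-a^x_2)\right]$ and $\frac{\partial\tilde f}{\partial\bar z}(T)=\frac12\left[(a^x_1-a^y_2)+i(a^y_1+a^x_2)\right]$. The Beltrami coefficient $\tilde\mu$ is the complex-valued function on the set of triangular faces given by the quotient $\tilde\mu(T)=\frac{\partial \tilde f}{\partial\bar z}(T)/\frac{\partial\tilde f}{\partial z}(T)$; it is well-defined when the denominator is nonzero on every face. The Beltrami Adjustment Module is a procedure that outputs a continuous, piecewise affine deformation of the image domain $\Omega$ to itself, fixing every point of the boundary $\partial\Omega$. *)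

theory Defs
  imports "HOL-Analysis.Analysis"
begin

definition Omega :: "complex set" where
  "Omega = cbox (Complex (-1) (-1)) (Complex 1 1)"

definition grid_vertex :: "nat \<Rightarrow> nat \<Rightarrow> nat \<Rightarrow> nat \<Rightarrow> complex" where
  "grid_vertex H W i j =
     Complex (2 * real i / (real H - 1) - 1) (2 * real j / (real W - 1) - 1)"

text \<open>
  The diagonal may be chosen independently in every grid rectangle: \<open>d i j\<close> says that the
  rectangle with lower left vertex \<open>(i, j)\<close> is cut by the diagonal through that vertex, and
  \<open>\<not> d i j\<close> that it is cut by the other one. A constant \<open>d\<close> gives the uniform triangulations.
\<close>

definition cell_faces ::
  "(nat \<Rightarrow> nat \<Rightarrow> bool) \<Rightarrow> nat \<Rightarrow> nat \<Rightarrow> nat \<Rightarrow> nat \<Rightarrow> complex set set" where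
  "cell_faces d H W i j =
     (let v00 = grid_vertex H W i j;
          v10 = grid_vertex H W (Suc i) j;
          v01 = grid_vertex H W i (Suc j);
          v11 = grid_vertex H W (Suc i) (Suc j)
      in if d i j
         then {convex hull {v00, v10, v11}, convex hull {v00, v01, v11}}
         else {convex hull {v10, v01, v00}, convex hull {v10, v01, v11}})"

definition faces :: "(nat \<Rightarrow> nat \<Rightarrow> bool) \<Rightarrow> nat \<Rightarrow> nat \<Rightarrow> complex set set" where
  "faces d H W = (\<Union>i\<in>{..<H - 1}. \<Union>j\<in>{..<W - 1}. cell_faces d H W i j)"

definition affine_coeffs_on ::
  "(complex \<Rightarrow> complex) \<Rightarrow> complex set \<Rightarrow>
     real \<Rightarrow> real \<Rightarrow> real \<Rightarrow> real \<Rightarrow> real \<Rightarrow> real \<Rightarrow> bool" where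
  "affine_coeffs_on f T ax1 ax2 bx ay1 ay2 by' \<longleftrightarrow>
     (\<forall>x y. Complex x y \<in> T \<longrightarrow>
        f (Complex x y) = Complex (ax1 * x + ax2 * y + bx) (ay1 * x + ay2 * y + by'))"

definition affine_map_on :: "(complex \<Rightarrow> complex) \<Rightarrow> complex set \<Rightarrow> bool" where
  "affine_map_on f T \<longleftrightarrow>
     (\<exists>ax1 ax2 bx ay1 ay2 by'. affine_coeffs_on f T ax1 ax2 bx ay1 ay2 by')"

text \<open>
  The mappings output by the Beltrami Adjustment Module (BAM) enter only through the following
  properties. Values of \<open>f\<close> outside \<open>Omega\<close> are irrelevant throughout.
\<close>

definition BAM_output ::
  "(nat \<Rightarrow> nat \<Rightarrow> bool) \<Rightarrow> nat \<Rightarrow> nat \<Rightarrow> (complex \<Rightarrow> complex) \<Rightarrow> bool" where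
  "BAM_output d H W f \<longleftrightarrow>
     f \<in> Omega \<rightarrow> Omega \<and> continuous_on Omega f \<and>
     (\<forall>T\<in>faces d H W. affine_map_on f T) \<and>
     (\<forall>z\<in>frontier Omega. f z = z)"

definition partial_x :: "(complex \<Rightarrow> complex) \<Rightarrow> complex \<Rightarrow> complex" where
  "partial_x f z = vector_derivative (\<lambda>t. f (z + of_real t)) (at 0)"

definition partial_y :: "(complex \<Rightarrow> complex) \<Rightarrow> complex \<Rightarrow> complex" where
  "partial_y f z = vector_derivative (\<lambda>t. f (z + \<i> * of_real t)) (at 0)"

definition wirtinger_dz :: "(complex \<Rightarrow> complex) \<Rightarrow> complex \<Rightarrow> complex" where
  "wirtinger_dz f z = (partial_x f z - \<i> * partial_y f z) / 2"

definition wirtinger_dzbar :: "(complex \<Rightarrow> complex) \<Rightarrow> complex \<Rightarrow> complex" where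
  "wirtinger_dzbar f z = (partial_x f z + \<i> * partial_y f z) / 2"

text \<open>
  The constant value of a derivative on a face is read off in the interior of the face, since
  \<open>f\<close> is in general not differentiable across edges. The lemmas \<open>face_dz_affine\<close> and
  \<open>face_dzbar_affine\<close> below express these values by the coefficients of the affine map;
  \<open>interior_face_nonempty\<close> shows that the description is proper for every face.
\<close>

definition face_dz :: "(complex \<Rightarrow> complex) \<Rightarrow> complex set \<Rightarrow> complex" where
  "face_dz f T = (THE c. \<forall>z\<in>interior T. wirtinger_dz f z = c)"

definition face_dzbar :: "(complex \<Rightarrow> complex) \<Rightarrow> complex set \<Rightarrow> complex" where
  "face_dzbar f T = (THE c. \<forall>z\<in>interior T. wirtinger_dzbar f z = c)"

text \<open>
  Division by zero yields \<open>0\<close>, so well-definedness has to be required separately.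
\<close>

definition beltrami :: "(complex \<Rightarrow> complex) \<Rightarrow> complex set \<Rightarrow> complex" where
  "beltrami f T = face_dzbar f T / face_dz f T"

definition beltrami_well_defined ::
  "(complex \<Rightarrow> complex) \<Rightarrow> complex set set \<Rightarrow> bool" where
  "beltrami_well_defined f \<T> \<longleftrightarrow> (\<forall>T\<in>\<T>. face_dz f T \<noteq> 0)"

lemma partials_affine:
  assumes "affine_coeffs_on f T ax1 ax2 bx ay1 ay2 by'" and z: "z \<in> interior T"
  shows "partial_x f z = Complex ax1 ay1" "partial_y f z = Complex ax2 ay2"
proof -
  define g where "g = (\<lambda>w. Complex (ax1 * Re w + ax2 * Im w + bx) (ay1 * Re w + ay2 * Im w + by'))"
  have fg: "f w = g w" if "w \<in> interior T" for w
    using assms(1) that interior_subset[of T]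
    by (cases w) (auto simp: affine_coeffs_on_def g_def)
  have line: "((\<lambda>t. f (z + u * of_real t)) has_vector_derivative
      Complex (ax1 * Re u + ax2 * Im u) (ay1 * Re u + ay2 * Im u)) (at 0)" for u
  proof -
    define S where "S = (\<lambda>t::real. z + u * of_real t) -` interior T"
    have "open S"
      unfolding S_def by (intro open_vimage open_interior continuous_intros)
    moreover have "0 \<in> S" using z by (simp add: S_def)
    moreover have "((\<lambda>t. g (z + u * of_real t)) has_vector_derivative
      Complex (ax1 * Re u + ax2 * Im u) (ay1 * Re u + ay2 * Im u)) (at 0)"
    proof -
      have "g (z + u * of_real t) = g z + t *\<^sub>R Complex (ax1 * Re u + ax2 * Im u) (ay1 * Re u + ay2 * Im u)" for t
        by (simp add: g_def complex_eq_iff algebra_simps)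
      then show ?thesis by (auto intro!: derivative_eq_intros)
    qed
    moreover have "g (z + u * of_real t) = f (z + u * of_real t)" if "t \<in> S" for t
      using that by (simp add: S_def fg)
    ultimately show ?thesis
      by (metis (no_types, lifting) has_vector_derivative_transform_within_open)
  qed
  show "partial_x f z = Complex ax1 ay1"
    unfolding partial_x_def using vector_derivative_at[OF line[of 1]] by simp
  show "partial_y f z = Complex ax2 ay2"
    unfolding partial_y_def using vector_derivative_at[OF line[of \<i>]] by simp
qed

lemma face_dz_affine:
  assumes "affine_coeffs_on f T ax1 ax2 bx ay1 ay2 by'" and "interior T \<noteq> {}"
  shows "face_dz f T = (of_real (ax1 + ay2) + \<i> * of_real (ay1 - ax2)) / 2"
  unfolding face_dz_def
proof (rule the_equality)
  show *: "\<forall>z\<in>interior T. wirtinger_dz f z = (of_real (ax1 + ay2) + \<i> * of_real (ay1 - ax2)) / 2"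
    using partials_affine[OF assms(1)] by (simp add: wirtinger_dz_def complex_eq_iff)
  show "c = (of_real (ax1 + ay2) + \<i> * of_real (ay1 - ax2)) / 2"
    if "\<forall>z\<in>interior T. wirtinger_dz f z = c" for c :: complex
    using that * assms(2) by (metis equals0I)
qed

lemma face_dzbar_affine:
  assumes "affine_coeffs_on f T ax1 ax2 bx ay1 ay2 by'" and "interior T \<noteq> {}"
  shows "face_dzbar f T = (of_real (ax1 - ay2) + \<i> * of_real (ay1 + ax2)) / 2"
  unfolding face_dzbar_def
proof (rule the_equality)
  show *: "\<forall>z\<in>interior T. wirtinger_dzbar f z = (of_real (ax1 - ay2) + \<i> * of_real (ay1 + ax2)) / 2"
    using partials_affine[OF assms(1)] by (simp add: wirtinger_dzbar_def complex_eq_iff)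
  show "c = (of_real (ax1 - ay2) + \<i> * of_real (ay1 + ax2)) / 2"
    if "\<forall>z\<in>interior T. wirtinger_dzbar f z = c" for c :: complex
    using that * assms(2) by (metis equals0I)
qed

lemma interior_triangle_nonempty:
  fixes a b c :: complex
  assumes "(Re b - Re a) * (Im c - Im a) \<noteq> (Im b - Im a) * (Re c - Re a)"
  shows "interior (convex hull {a, b, c}) \<noteq> {}"
proof -
  have "\<not> collinear {a, b, c}"
  proof
    assume "collinear {a, b, c}"
    then have "collinear {b, a, c}" by (simp add: insert_commute)
    then consider "b = c" | u where "a = u *\<^sub>R b + (1 - u) *\<^sub>R c"
      by (auto simp: collinear_3_expand)
    then show False
    proof cases
      case 1
      then show ?thesis using assms by simp
    next
      case 2
      have "Re a = u * Re b + (1 - u) * Re c" "Im a = u * Im b + (1 - u) * Im c"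
        using 2 by simp_all
      then have "(Re b - Re a) * (Im c - Im a) = (Im b - Im a) * (Re c - Re a)"
        by (simp only:) (simp add: algebra_simps)
      then show ?thesis using assms by contradiction
    qed
  qed
  then have "interior (convex hull {a, b, c}) =
      {v. \<exists>x y z. 0 < x \<and> 0 < y \<and> 0 < z \<and> x + y + z = 1 \<and> x *\<^sub>R a + y *\<^sub>R b + z *\<^sub>R c = v}"
    by (rule interior_convex_hull_3_minimal) simp
  moreover have "\<exists>x y z::real. 0 < x \<and> 0 < y \<and> 0 < z \<and> x + y + z = 1"
    by (rule exI[of _ "1/3"])+ simp
  ultimately show ?thesis by blast
qed

lemma interior_face_nonempty:
  assumes "H \<ge> 2" "W \<ge> 2" "T \<in> faces d H W"
  shows "interior T \<noteq> {}"
proof -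
  obtain i j where T: "T \<in> cell_faces d H W i j"
    using assms(3) by (auto simp: faces_def)
  have H: "real H - 1 > 0" and W: "real W - 1 > 0" using assms by auto
  have step: "2 * real (Suc i) / (real H - 1) - 1 = (2 * real i / (real H - 1) - 1) + 2 / (real H - 1)"
    "2 * real (Suc j) / (real W - 1) - 1 = (2 * real j / (real W - 1) - 1) + 2 / (real W - 1)"
    by (simp_all add: distrib_left add_divide_distrib)
  have nz: "2 / (real H - 1) \<noteq> 0" "2 / (real W - 1) \<noteq> 0" using H W by auto
  define x y p q where "x = 2 * real i / (real H - 1) - 1" and "y = 2 * real j / (real W - 1) - 1"
    and "p = 2 / (real H - 1)" and "q = 2 / (real W - 1)"
  have "T \<in> {convex hull {Complex x y, Complex (x + p) y, Complex (x + p) (y + q)},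
      convex hull {Complex x y, Complex x (y + q), Complex (x + p) (y + q)},
      convex hull {Complex (x + p) y, Complex x (y + q), Complex x y},
      convex hull {Complex (x + p) y, Complex x (y + q), Complex (x + p) (y + q)}}"
    using T unfolding cell_faces_def Let_def grid_vertex_def step
    unfolding x_def[symmetric] y_def[symmetric] p_def[symmetric] q_def[symmetric]
    by (simp split: if_splits) blast+
  moreover have "p \<noteq> 0" "q \<noteq> 0" using nz by (simp_all add: p_def q_def)
  ultimately show ?thesis
    by (elim insertE emptyE; hypsubst; intro interior_triangle_nonempty) simp_all
qed

end

theory Submission
  imports Defs
begin

text \<open>
  On a face with vertices \<open>a\<close>, \<open>b\<close>, \<open>c\<close>, the coefficient is defined and of modulus less than one
  iff \<open>f\<close> preserves the orientation of \<open>a\<close>, \<open>b\<close>, \<open>c\<close>.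

  If \<open>f\<close> is injective, a face with an edge on the bottom side of the square is not reversed, as
  that edge is fixed and the apex stays in the square; and two faces sharing an edge have the same
  orientation behaviour, since otherwise \<open>f\<close> folds along the edge.

  Conversely, if all orientations are preserved, then \<open>f\<close> is locally injective at every point that
  is not a grid vertex, hence locally open there by invariance of domain. Finitely many exceptional
  points do not disconnect a planar domain, so clopen arguments show that \<open>f\<close> is onto and open in
  the interior, and that the set of points with several preimages either is empty or reaches the
  boundary; the latter contradicts that \<open>f\<close> fixes the boundary and maps the interior to itself.
\<close>

section \<open>Locally injective maps fixing the frontier\<close>

text \<open>The open set \<open>D - closure (D - F)\<close> lies in the finite set \<open>F\<close>,
  and a nonempty open set in a Euclidean space is infinite.\<close>

lemma subset_closure_Diff_finite:
  fixes D :: "'a::euclidean_space set"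
  assumes "open D" "finite F"
  shows "D \<subseteq> closure (D - F)"
proof -
  have "D - closure (D - F) \<subseteq> F" using closure_subset[of "D - F"] by blast
  then have "finite (D - closure (D - F))" using assms(2) by (rule finite_subset)
  then have "D - closure (D - F) = {}"
    using assms(1) by (intro finite_imp_not_open) auto
  then show ?thesis by blast
qed

text \<open>Invariance of domain applies to every \<open>N \<inter> U\<close> on which
  \<open>f\<close> is injective, because source and target have the same dimension.\<close>

lemma open_map_if_locally_inj:
  fixes f :: "'a::euclidean_space \<Rightarrow> 'a"
  assumes cont: "continuous_on U f" and U: "open U"
    and loc: "\<And>x. x \<in> U \<Longrightarrow> \<exists>N. open N \<and> x \<in> N \<and> inj_on f (N \<inter> U)"
  shows "open (f ` U)"
proof (subst open_subopen, safe)
  fix x assume x: "x \<in> U"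
  obtain N where N: "open N" "x \<in> N" "inj_on f (N \<inter> U)" using loc[OF x] by blast
  have "open (f ` (N \<inter> U))"
    using N U cont by (intro invariance_of_domain) (auto intro: continuous_on_subset)
  then show "\<exists>T. open T \<and> f x \<in> T \<and> T \<subseteq> f ` U"
    using N x by (intro exI[of _ "f ` (N \<inter> U)"]) auto
qed

text \<open>The part of \<open>D - f ` V\<close> covered by \<open>f ` K\<close> is relatively clopen, and removing finitely many
  points does not disconnect \<open>D\<close>.\<close>

lemma covers_connected_open:
  fixes f :: "'a::euclidean_space \<Rightarrow> 'a"
  assumes dim: "2 \<le> DIM('a)" and K: "compact K" and cont: "continuous_on K f"
    and D: "open D" "connected D" and V: "finite V"
    and fr: "f ` frontier K \<inter> D = {}"
    and loc: "\<And>x. x \<in> interior K - V \<Longrightarrow> \<exists>N. open N \<and> x \<in> N \<and> inj_on f (N \<inter> K)"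
    and ne: "f ` K \<inter> (D - f ` V) \<noteq> {}"
  shows "D \<subseteq> f ` K"
proof -
  define G where "G = D - f ` V"
  have G: "open G" "connected G"
    using D V dim by (auto simp: G_def finite_imp_closed open_Diff
        intro!: connected_open_diff_countable countable_finite)
  have "closed (f ` K)" using compact_continuous_image[OF cont K] by (rule compact_imp_closed)
  then have "closedin (top_of_set G) (f ` K \<inter> G)"
    by (metis Int_commute closedin_closed_Int)
  moreover have "open (f ` K \<inter> G)"
  proof (subst open_subopen, safe)
    fix x assume x: "x \<in> K" "f x \<in> G"
    define U where "U = interior K - V"
    \<comment> \<open>Since \<open>f x\<close> lies in \<open>D\<close>, the point \<open>x\<close>
      is not on the frontier of \<open>K\<close>; since \<open>f x\<close> avoids the image of
      \<open>V\<close>, it is not in \<open>V\<close>.\<close>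
    have "x \<in> U" using x fr K unfolding U_def G_def
      by (auto simp: frontier_def compact_imp_closed)
    moreover have "open U"
      unfolding U_def using V by (simp add: finite_imp_closed open_Diff)
    moreover have "U \<subseteq> K" unfolding U_def using interior_subset by auto
    moreover have "open (f ` U)"
    proof (rule open_map_if_locally_inj)
      show "continuous_on U f" using cont \<open>U \<subseteq> K\<close> by (rule continuous_on_subset)
      fix z assume "z \<in> U"
      then obtain N where "open N" "z \<in> N" "inj_on f (N \<inter> K)" using loc unfolding U_def by blast
      then show "\<exists>N. open N \<and> z \<in> N \<and> inj_on f (N \<inter> U)"
        using \<open>U \<subseteq> K\<close> by (meson inf_mono inj_on_subset order_refl)
    qed fact
    ultimately show "\<exists>T. open T \<and> f x \<in> T \<and> T \<subseteq> f ` K \<inter> G"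
      using x G by (intro exI[of _ "f ` U \<inter> G"]) auto
  qed
  then have "openin (top_of_set G) (f ` K \<inter> G)"
    by (simp add: open_subset)
  ultimately have "f ` K \<inter> G = G"
    using G(2) ne unfolding connected_clopen G_def by blast
  \<comment> \<open>The image of \<open>K\<close> is closed, so it also catches the finitely many
    points that were removed from \<open>D\<close>.\<close>
  then have "closure G \<subseteq> f ` K"
    using \<open>closed (f ` K)\<close> by (metis closure_minimal inf.absorb_iff2)
  then show ?thesis
    using subset_closure_Diff_finite[OF D(1), of "f ` V"] V by (auto simp: G_def)
qed

section \<open>From local injectivity to bijectivity\<close>

text \<open>At the points of \<open>V\<close> nothing is assumed about local injectivity; finite
  fibres make up for this, as they isolate each point from the rest of its fibre. The infinite
  frontier supplies a fixed point outside the image of \<open>V\<close>.\<close>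

theorem bij_betw_if_locally_inj_fixing_frontier:
  fixes f :: "'a::euclidean_space \<Rightarrow> 'a"
  assumes dim: "2 \<le> DIM('a)" and S: "compact S" "convex S" "interior S \<noteq> {}" "infinite (frontier S)"
    and f: "f \<in> S \<rightarrow> S" and cont: "continuous_on S f"
    and fr: "\<And>x. x \<in> frontier S \<Longrightarrow> f x = x"
    and V: "finite V" and fib: "\<And>y. finite {x \<in> S. f x = y}"
    and loc: "\<And>x. x \<in> S - V \<Longrightarrow> \<exists>N. open N \<and> x \<in> N \<and> inj_on f (N \<inter> S)"
  shows "bij_betw f S S"
proof -
  have "closed S" using S(1) by (rule compact_imp_closed)
  have split: "x \<in> interior S \<or> x \<in> frontier S" if "x \<in> S" for x
    using that closure_subset unfolding frontier_def by blast
  have intS: "interior S \<subseteq> S" by (rule interior_subset)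
  have frS: "frontier S \<subseteq> S" using \<open>closed S\<close> by (rule frontier_subset_closed)
  have nofin: "\<exists>x\<in>A. f x \<notin> f ` V" if "infinite A" "A \<subseteq> S" for A
  proof (rule ccontr)
    assume "\<not> ?thesis"
    then have "A \<subseteq> (\<Union>y\<in>f ` V. {x \<in> S. f x = y})" using that(2) by auto
    then show False using that(1) V fib by (meson finite_UN finite_imageI finite_subset)
  qed
  \<comment> \<open>Openness holds even at points of \<open>V\<close>: a small ball around
    \<open>x\<close> avoids the rest \<open>F\<close> of the fibre, so the image of its sphere keeps
    a distance \<open>m\<close> from \<open>f x\<close>, and the image of the closed ball then
    covers \<open>ball (f x) m\<close>.\<close>
  have openmap: "\<exists>T. open T \<and> f x \<in> T \<and> T \<subseteq> f ` (U \<inter> interior S)"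
    if U: "open U" "x \<in> U" and x: "x \<in> interior S" for U x
  proof -
    define F where "F = {z \<in> S. f z = f x} - {x}"
    have "finite F" unfolding F_def using fib by blast
    then have "open (U \<inter> interior S - F)" using U by (intro open_Diff open_Int finite_imp_closed open_interior)
    moreover have "x \<in> U \<inter> interior S - F" using U x by (simp add: F_def)
    ultimately obtain r where r: "r > 0" "cball x r \<subseteq> U \<inter> interior S - F"
      by (meson open_contains_cball)
    have rS: "cball x r \<subseteq> S" using r intS by blast
    then have cr: "continuous_on (cball x r) f" using cont by (rule continuous_on_subset[rotated])
    have "compact (f ` sphere x r)"
      using cr by (intro compact_continuous_image compact_sphere) (rule continuous_on_subset, auto)
    then have "open (- f ` sphere x r)" by (simp add: compact_imp_closed open_Compl)
    moreover have "f x \<notin> f ` sphere x r"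
    proof
      assume "f x \<in> f ` sphere x r"
      then obtain z where z: "z \<in> sphere x r" "f z = f x" by auto
      then have "z \<in> cball x r" "z \<noteq> x" using r(1) by auto
      then show False using z r(2) rS unfolding F_def by blast
    qed
    ultimately obtain m where m: "m > 0" "ball (f x) m \<subseteq> - f ` sphere x r"
      by (metis ComplI openE)
    \<comment> \<open>A nonempty open set is infinite, so by \<open>nofin\<close> it contains a
      point whose value avoids the image of \<open>V\<close>; this starts the covering argument even
      if \<open>f x\<close> itself is exceptional.\<close>
    have "open (ball x r \<inter> f -` ball (f x) m)"
      by (rule continuous_open_preimage[OF continuous_on_subset[OF cr]]) auto
    moreover have "x \<in> ball x r \<inter> f -` ball (f x) m" using r(1) m(1) by simp
    ultimately have inf: "infinite (ball x r \<inter> f -` ball (f x) m)"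
      using finite_imp_not_open[of "ball x r \<inter> f -` ball (f x) m"] by blast
    have "ball x r \<inter> f -` ball (f x) m \<subseteq> S" using rS by auto
    then obtain z where z: "z \<in> ball x r" "f z \<in> ball (f x) m" "f z \<notin> f ` V"
      using nofin[OF inf] by blast
    have "ball (f x) m \<subseteq> f ` cball x r"
    proof (rule covers_connected_open[OF dim compact_cball cr open_ball _ V])
      show "f ` frontier (cball x r) \<inter> ball (f x) m = {}" using m(2) r(1) by auto
      show "f ` cball x r \<inter> (ball (f x) m - f ` V) \<noteq> {}"
        using z ball_subset_cball by blast
      show "\<exists>N. open N \<and> y \<in> N \<and> inj_on f (N \<inter> cball x r)" if "y \<in> interior (cball x r) - V" for y
      proof -
        have "y \<in> S - V" using that rS interior_subset by blast
        then obtain N where "open N" "y \<in> N" "inj_on f (N \<inter> S)" using loc by blast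
        then show ?thesis using rS by (meson inf_mono inj_on_subset order_refl)
      qed
    qed simp
    moreover have "f ` cball x r \<subseteq> f ` (U \<inter> interior S)" using r(2) by blast
    ultimately show ?thesis using m(1) by (intro exI[of _ "ball (f x) m"]) auto
  qed
  have f_int: "f x \<in> interior S" if x: "x \<in> interior S" for x
  proof -
    obtain T where "open T" "f x \<in> T" "T \<subseteq> f ` interior S"
      using openmap[of UNIV x] x by auto
    then show ?thesis using f intS by (intro interiorI[of T]) auto
  qed
  have in_int: "x \<in> interior S" if "x \<in> S" "f x \<in> interior S" for x
    using split[OF that(1)] that(2) fr by (auto simp: frontier_def)
  \<comment> \<open>Interior points have interior images by \<open>f_int\<close>, so
    \<open>x\<close> must lie on the frontier, where \<open>f\<close> is the identity.\<close>
  have fr_inj: "x = f x" if "x \<in> S" "f x \<in> frontier S" for x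
    using split[OF that(1)] that(2) fr f_int by (fastforce simp: frontier_def)
  define G where "G = interior S - f ` V"
  have conI: "connected (interior S)" using S(2) by (simp add: convex_connected)
  then have G: "open G" "connected G"
    using V dim by (auto simp: G_def finite_imp_closed open_Diff
        intro!: connected_open_diff_countable countable_finite)
  have "closure (interior S) = S"
    using S \<open>closed S\<close> by (simp add: convex_closure_interior)
  moreover have "closure (interior S) \<subseteq> closure G"
    unfolding G_def using V by (intro closure_minimal subset_closure_Diff_finite) auto
  ultimately have clG: "S \<subseteq> closure G" by simp
  have infI: "infinite (interior S)" using S(3) finite_imp_not_open by blast
  have "interior S \<subseteq> f ` S"
  proof (rule covers_connected_open[OF dim S(1) cont open_interior conI V])
    show "f ` frontier S \<inter> interior S = {}" using fr by (auto simp: frontier_def)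
    show "f ` S \<inter> (interior S - f ` V) \<noteq> {}"
      using nofin[OF infI intS] f_int intS by blast
    show "\<exists>N. open N \<and> x \<in> N \<and> inj_on f (N \<inter> S)" if "x \<in> interior S - V" for x
      using that intS by (intro loc) blast
  qed
  moreover have "frontier S \<subseteq> f ` S"
    using fr frS by (metis image_eqI subset_eq)
  ultimately have surj: "f ` S = S" using f split by blast

  \<comment> \<open>The pairs of distinct points with equal values need not form a closed set.
    Removing the open set \<open>W\<close> from all pairs with equal values leaves exactly these
    pairs and the diagonal pairs over points of \<open>V\<close> in \<open>S\<close>, hence a
    compact set \<open>Z\<close>.\<close>
  define W where "W = (\<Union>N\<in>{N. open N \<and> inj_on f (N \<inter> S) \<and> N \<inter> V = {}}. N \<times> N)"
  define Z where "Z = {z \<in> S \<times> S. f (fst z) = f (snd z)} - W"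
  have Z: "p \<noteq> q \<or> p \<in> V" "p \<in> S" "q \<in> S" "f p = f q" if "(p, q) \<in> Z" for p q
  proof -
    show *: "p \<in> S" "q \<in> S" "f p = f q" using that by (auto simp: Z_def)
    show "p \<noteq> q \<or> p \<in> V"
    proof (rule ccontr)
      assume n: "\<not> (p \<noteq> q \<or> p \<in> V)"
      then obtain N where "open N" "p \<in> N" "inj_on f (N \<inter> S)" using loc[of p] * by blast
      then have "open (N - V)" "p \<in> N - V" "inj_on f ((N - V) \<inter> S)" "(N - V) \<inter> V = {}"
        using V n by (auto simp: finite_imp_closed open_Diff intro: inj_on_subset)
      then have "(p, q) \<in> W" using n unfolding W_def by blast
      then show False using that by (simp add: Z_def)
    qed
  qed
  have ZI: "(p, q) \<in> Z" if "p \<in> S" "q \<in> S" "f p = f q" "p \<noteq> q" for p q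
    using that by (auto simp: Z_def W_def inj_on_def)
  have "compact Z"
  proof -
    have "closed {z \<in> S \<times> S. f (fst z) - f (snd z) = 0}"
    proof (rule continuous_closed_preimage_constant)
      show "continuous_on (S \<times> S) (\<lambda>z. f (fst z) - f (snd z))"
        by (intro continuous_intros continuous_on_compose2[OF cont]) auto
    qed (simp add: \<open>closed S\<close> closed_Times)
    moreover have "open W" unfolding W_def by (auto intro: open_Times)
    ultimately have "closed Z" unfolding Z_def by (simp add: closed_Diff)
    moreover have "Z = (S \<times> S) \<inter> Z" by (auto simp: Z_def)
    ultimately show ?thesis using S(1) by (metis compact_Int_closed compact_Times)
  qed
  define C where "C = (\<lambda>z. f (fst z)) ` Z"
  have "compact C"
    unfolding C_def using \<open>compact Z\<close> Z
    by (intro compact_continuous_image continuous_on_compose2[OF cont] continuous_intros) auto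
  then have "closed C" by (rule compact_imp_closed)
  \<comment> \<open>A value outside the image of \<open>V\<close> cannot come from a diagonal pair
    of \<open>Z\<close>, so it is a genuine double value.\<close>
  have CD: "\<exists>p\<in>S. \<exists>q\<in>S. p \<noteq> q \<and> f p = y \<and> f q = y" if y: "y \<in> C" "y \<notin> f ` V" for y
  proof -
    obtain p q where "(p, q) \<in> Z" "f p = y" using y(1) unfolding C_def by auto
    then show ?thesis using Z[of p q] y(2) by (metis imageI)
  qed
  have CI: "f p \<in> C" if "p \<in> S" "q \<in> S" "f p = f q" "p \<noteq> q" for p q
    using ZI[OF that] unfolding C_def by force
  \<comment> \<open>Disjoint neighbourhoods of \<open>p\<close> and \<open>q\<close> both cover a
    neighbourhood of the common value, so every value nearby is attained twice.\<close>
  have CG: "\<exists>T. open T \<and> f p \<in> T \<and> T \<subseteq> C"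
    if pq: "p \<in> interior S" "q \<in> interior S" "f p = f q" "p \<noteq> q" for p q
  proof -
    obtain U U' where U: "open U" "open U'" "p \<in> U" "q \<in> U'" "U \<inter> U' = {}"
      using hausdorff[OF pq(4)] by blast
    obtain T where T: "open T" "f p \<in> T" "T \<subseteq> f ` (U \<inter> interior S)"
      using openmap U pq by blast
    obtain T' where T': "open T'" "f q \<in> T'" "T' \<subseteq> f ` (U' \<inter> interior S)"
      using openmap U pq by blast
    have "T \<inter> T' \<subseteq> C"
    proof
      fix y assume y: "y \<in> T \<inter> T'"
      obtain x where x: "x \<in> U" "x \<in> interior S" "f x = y" using y T(3) by blast
      obtain x' where x': "x' \<in> U'" "x' \<in> interior S" "f x' = y" using y T'(3) by blast
      have "x \<noteq> x'" using x x' U(5) by blast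
      then show "y \<in> C" using CI[of x x'] x x' intS by auto
    qed
    then show ?thesis using T T' pq(3) by (intro exI[of _ "T \<inter> T'"]) auto
  qed
  have "open (C \<inter> G)"
  proof (subst open_subopen, safe)
    fix y assume y: "y \<in> C" "y \<in> G"
    then obtain p q where pq: "p \<in> S" "q \<in> S" "p \<noteq> q" "f p = y" "f q = y"
      using CD[of y] unfolding G_def by blast
    then have "p \<in> interior S" "q \<in> interior S" using in_int y unfolding G_def by auto
    then obtain T where "open T" "y \<in> T" "T \<subseteq> C" using CG[of p q] pq by auto
    then show "\<exists>T. open T \<and> y \<in> T \<and> T \<subseteq> C \<inter> G"
      using G(1) y by (intro exI[of _ "T \<inter> G"]) auto
  qed
  then have "openin (top_of_set G) (C \<inter> G)"
    by (simp add: open_subset)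
  moreover have "closedin (top_of_set G) (C \<inter> G)"
    using \<open>closed C\<close> by (metis Int_commute closedin_closed_Int)
  ultimately have "C \<inter> G = {} \<or> C \<inter> G = G" using G(2) unfolding connected_clopen by blast
  \<comment> \<open>Otherwise the closed set \<open>C\<close> would contain all of \<open>S\<close>,
    in particular a frontier point \<open>b\<close> outside the image of \<open>V\<close>. By
    \<open>fr_inj\<close>, such a point has only itself as preimage.\<close>
  moreover have "C \<inter> G \<noteq> G"
  proof
    assume "C \<inter> G = G"
    then have "closure G \<subseteq> C" using \<open>closed C\<close> by (metis closure_minimal inf.absorb_iff2)
    moreover obtain b where b: "b \<in> frontier S" "b \<notin> f ` V"
      using S(4) V by (meson finite_imageI finite_subset subsetI)
    ultimately have "b \<in> C" using clG frS by blast
    then show False using CD[of b] b fr_inj by metis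
  qed
  ultimately have CG0: "C \<inter> G = {}" by blast
  have "inj_on f S"
  proof (rule inj_onI, rule ccontr)
    fix p q assume pq: "p \<in> S" "q \<in> S" "f p = f q" "p \<noteq> q"
    have "f p \<in> S" using f pq(1) by blast
    then consider "f p \<in> interior S" | "f p \<in> frontier S" using split by blast
    then show False
    proof cases
      case 1
      \<comment> \<open>Double values in the image of \<open>V\<close> remain to be excluded: by
        \<open>CG\<close> they come with an open set of double values, which would have to meet
        \<open>G\<close>.\<close>
      then obtain T where T: "open T" "f p \<in> T" "T \<subseteq> C" using CG[of p q] pq in_int by auto
      have "T \<inter> interior S \<subseteq> f ` V" using T(3) CG0 unfolding G_def by blast
      then have "finite (T \<inter> interior S)" using V by (meson finite_imageI finite_subset)
      then have "T \<inter> interior S = {}" using T(1) by (intro finite_imp_not_open) auto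
      then show ?thesis using T(2) 1 by blast
    next
      case 2
      then show ?thesis using fr_inj pq by metis
    qed
  qed
  then show ?thesis using surj by (simp add: bij_betw_def)
qed

section \<open>Maps that are affine on triangles\<close>

text \<open>Twice the signed area of the triangle, positive iff its vertices run
  counterclockwise.\<close>

definition orient :: "complex \<Rightarrow> complex \<Rightarrow> complex \<Rightarrow> real" where
  "orient a b c = (Re b - Re a) * (Im c - Im a) - (Im b - Im a) * (Re c - Re a)"

lemma orient_rotate: "orient b c a = orient a b c"
  and orient_swap: "orient a c b = - orient a b c"
  by (simp_all add: orient_def algebra_simps)

lemma orient_convex_comb:
  assumes "u + v + w = 1"
  shows "orient (u *\<^sub>R a + v *\<^sub>R b + w *\<^sub>R c) b c = u * orient a b c"
    and "orient a (u *\<^sub>R a + v *\<^sub>R b + w *\<^sub>R c) c = v * orient a b c"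
    and "orient a b (u *\<^sub>R a + v *\<^sub>R b + w *\<^sub>R c) = w * orient a b c"
proof -
  have u: "u = 1 - v - w" using assms by simp
  show "orient (u *\<^sub>R a + v *\<^sub>R b + w *\<^sub>R c) b c = u * orient a b c"
    "orient a (u *\<^sub>R a + v *\<^sub>R b + w *\<^sub>R c) c = v * orient a b c"
    "orient a b (u *\<^sub>R a + v *\<^sub>R b + w *\<^sub>R c) = w * orient a b c"
    unfolding orient_def u by (simp_all add: algebra_simps)
qed

text \<open>Cramer's rule: the ratios of signed areas are the barycentric coordinates of
  \<open>z\<close>, also when \<open>z\<close> lies outside the triangle.\<close>

lemma orient_barycentric:
  assumes "orient a b c \<noteq> 0"
  shows "orient z b c / orient a b c + orient a z c / orient a b c + orient a b z / orient a b c = 1"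
    and "(orient z b c / orient a b c) *\<^sub>R a + (orient a z c / orient a b c) *\<^sub>R b
           + (orient a b z / orient a b c) *\<^sub>R c = z"
proof -
  have "orient z b c + orient a z c + orient a b z = orient a b c"
    by (simp add: orient_def algebra_simps)
  then show "orient z b c / orient a b c + orient a z c / orient a b c + orient a b z / orient a b c = 1"
    using assms by (simp add: add_divide_distrib[symmetric])
  have "orient z b c * Re a + orient a z c * Re b + orient a b z * Re c = Re z * orient a b c"
    "orient z b c * Im a + orient a z c * Im b + orient a b z * Im c = Im z * orient a b c"
    by (simp_all add: orient_def algebra_simps)
  then show "(orient z b c / orient a b c) *\<^sub>R a + (orient a z c / orient a b c) *\<^sub>R b
           + (orient a b z / orient a b c) *\<^sub>R c = z"
    using assms by (simp add: complex_eq_iff field_simps)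
qed

text \<open>The three products have the signs of the barycentric coordinates of \<open>z\<close>;
  the factor \<open>orient a b c\<close> treats both orientations at once.\<close>

lemma in_triangle_if_orient:
  assumes "orient a b c \<noteq> 0"
    and "orient a b c * orient z b c \<ge> 0" "orient a b c * orient a z c \<ge> 0"
      "orient a b c * orient a b z \<ge> 0"
  shows "z \<in> convex hull {a, b, c}"
proof -
  have "0 \<le> t / orient a b c" if "orient a b c * t \<ge> 0" for t
    using that assms(1) by (simp add: zero_le_mult_iff zero_le_divide_iff) blast
  then show ?thesis
    unfolding convex_hull_3 mem_Collect_eq
    using orient_barycentric[OF assms(1), of z] assms(2-4) by metis
qed

lemma continuous_on_orient [continuous_intros]:
  assumes "continuous_on S f" "continuous_on S g" "continuous_on S h"
  shows "continuous_on S (\<lambda>z. orient (f z) (g z) (h z))"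
  unfolding orient_def by (intro continuous_intros assms)

lemma affine_map_on_convex_comb:
  assumes "affine_map_on f (convex hull {a, b, c})" "0 \<le> u" "0 \<le> v" "0 \<le> w" "u + v + w = 1"
  shows "f (u *\<^sub>R a + v *\<^sub>R b + w *\<^sub>R c) = u *\<^sub>R f a + v *\<^sub>R f b + w *\<^sub>R f c"
proof -
  obtain ax1 ax2 bx ay1 ay2 by' where
    *: "affine_coeffs_on f (convex hull {a, b, c}) ax1 ax2 bx ay1 ay2 by'"
    using assms(1) unfolding affine_map_on_def by blast
  have f: "f z = Complex (ax1 * Re z + ax2 * Im z + bx) (ay1 * Re z + ay2 * Im z + by')"
    if "z \<in> convex hull {a, b, c}" for z
    using * that unfolding affine_coeffs_on_def by (metis complex.collapse)
  have "u *\<^sub>R a + v *\<^sub>R b + w *\<^sub>R c \<in> convex hull {a, b, c}"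
    using assms by (auto simp: convex_hull_3)
  note f[OF this]
  moreover have "f z = Complex (ax1 * Re z + ax2 * Im z + bx) (ay1 * Re z + ay2 * Im z + by')"
    if "z \<in> {a, b, c}" for z
    using that by (intro f hull_inc)
  moreover have "u = 1 - v - w" using assms(5) by simp
  ultimately show ?thesis
    by (simp only: insert_iff simp_thms complex_eq_iff) (simp add: algebra_simps)
qed

text \<open>The squared moduli of the two Wirtinger derivatives differ by the Jacobian determinant,
  which is also the factor by which \<open>f\<close> scales signed areas.\<close>

lemma beltrami_less_1_iff_orient:
  assumes "affine_map_on f (convex hull {a, b, c})" and nz: "orient a b c \<noteq> 0"
  shows "face_dz f (convex hull {a, b, c}) \<noteq> 0 \<and> cmod (beltrami f (convex hull {a, b, c})) < 1
    \<longleftrightarrow> orient a b c * orient (f a) (f b) (f c) > 0"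
proof -
  define T where "T = convex hull {a, b, c}"
  obtain ax1 ax2 bx ay1 ay2 by' where
    *: "affine_coeffs_on f T ax1 ax2 bx ay1 ay2 by'"
    using assms(1) unfolding affine_map_on_def T_def by blast
  have int: "interior T \<noteq> {}"
    unfolding T_def using nz by (intro interior_triangle_nonempty) (simp add: orient_def)
  have f: "f z = Complex (ax1 * Re z + ax2 * Im z + bx) (ay1 * Re z + ay2 * Im z + by')"
    if "z \<in> {a, b, c}" for z
    using * that hull_inc[OF that, of convex] unfolding affine_coeffs_on_def T_def
    by (metis complex.collapse)
  have ori: "orient (f a) (f b) (f c) = (ax1 * ay2 - ax2 * ay1) * orient a b c"
    by (simp add: f orient_def algebra_simps)
  have "(cmod (face_dz f T))\<^sup>2 - (cmod (face_dzbar f T))\<^sup>2 = ax1 * ay2 - ax2 * ay1"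
    unfolding face_dz_affine[OF * int] face_dzbar_affine[OF * int] cmod_power2
    by (simp add: power2_eq_square field_simps)
  moreover have "cmod (face_dzbar f T) < cmod (face_dz f T) \<longleftrightarrow>
      (cmod (face_dzbar f T))\<^sup>2 < (cmod (face_dz f T))\<^sup>2"
    by (metis norm_ge_zero power2_less_imp_less power_strict_mono zero_less_numeral)
  moreover have "face_dz f T \<noteq> 0 \<and> cmod (beltrami f T) < 1 \<longleftrightarrow>
      cmod (face_dzbar f T) < cmod (face_dz f T)"
    unfolding beltrami_def by (auto simp: norm_divide divide_simps split: if_splits)
  moreover have "orient a b c * orient (f a) (f b) (f c) > 0 \<longleftrightarrow> ax1 * ay2 - ax2 * ay1 > 0"
  proof -
    have "orient a b c * orient (f a) (f b) (f c) = (orient a b c)\<^sup>2 * (ax1 * ay2 - ax2 * ay1)"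
      by (simp add: ori power2_eq_square)
    then show ?thesis using nz by (simp add: zero_less_mult_iff)
  qed
  ultimately show ?thesis unfolding T_def by linarith
qed

section \<open>Two triangles with a common edge\<close>

text \<open>The image triangles lie on opposite sides of the line through \<open>f a\<close> and
  \<open>f b\<close>, so a common value forces the coordinate opposite the shared edge to vanish.
  The case \<open>c = c'\<close> gives injectivity on a single triangle.\<close>

lemma inj_on_adjacent_triangles:
  assumes aff: "affine_map_on f (convex hull {a, b, c})" "affine_map_on f (convex hull {a, b, c'})"
    and nz: "orient (f a) (f b) (f c) \<noteq> 0" "orient (f a) (f b) (f c') \<noteq> 0"
    and opp: "c = c' \<or> orient (f a) (f b) (f c) * orient (f a) (f b) (f c') < 0"
  shows "inj_on f (convex hull {a, b, c} \<union> convex hull {a, b, c'})"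
proof -
  have same: "x = y"
    if "affine_map_on f (convex hull {a, b, c})" "orient (f a) (f b) (f c) \<noteq> 0"
      "x \<in> convex hull {a, b, c}" "y \<in> convex hull {a, b, c}" "f x = f y" for x y c
  proof -
    obtain u v w where x: "0 \<le> u" "0 \<le> v" "0 \<le> w" "u + v + w = 1"
      "x = u *\<^sub>R a + v *\<^sub>R b + w *\<^sub>R c"
      using \<open>x \<in> _\<close> unfolding convex_hull_3 by blast
    obtain u' v' w' where y: "0 \<le> u'" "0 \<le> v'" "0 \<le> w'" "u' + v' + w' = 1"
      "y = u' *\<^sub>R a + v' *\<^sub>R b + w' *\<^sub>R c"
      using \<open>y \<in> _\<close> unfolding convex_hull_3 by blast
    have fx: "f x = u *\<^sub>R f a + v *\<^sub>R f b + w *\<^sub>R f c"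
      and fy: "f y = u' *\<^sub>R f a + v' *\<^sub>R f b + w' *\<^sub>R f c"
      using affine_map_on_convex_comb[OF that(1)] x y by simp_all
    have "u * orient (f a) (f b) (f c) = u' * orient (f a) (f b) (f c)"
      "v * orient (f a) (f b) (f c) = v' * orient (f a) (f b) (f c)"
      "w * orient (f a) (f b) (f c) = w' * orient (f a) (f b) (f c)"
      \<comment> \<open>The signed areas spanned by the common value and two image vertices recover
        its barycentric coordinates.\<close>
      using orient_convex_comb[OF x(4), of "f a" "f b" "f c"]
        orient_convex_comb[OF y(4), of "f a" "f b" "f c"] \<open>f x = f y\<close> fx fy by metis+
    then show "x = y" using that(2) x(5) y(5) by simp
  qed
  have cross: "x = y"
    if x: "x \<in> convex hull {a, b, c}" and y: "y \<in> convex hull {a, b, c'}" and "f x = f y" for x y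
  proof (cases "c = c'")
    case True
    then show ?thesis using same[OF aff(1) nz(1) x _ \<open>f x = f y\<close>] y by simp
  next
    case False
    obtain u v w where x: "0 \<le> u" "0 \<le> v" "0 \<le> w" "u + v + w = 1"
      "x = u *\<^sub>R a + v *\<^sub>R b + w *\<^sub>R c"
      using x unfolding convex_hull_3 by blast
    obtain u' v' w' where y': "0 \<le> u'" "0 \<le> v'" "0 \<le> w'" "u' + v' + w' = 1"
      "y = u' *\<^sub>R a + v' *\<^sub>R b + w' *\<^sub>R c'"
      using y unfolding convex_hull_3 by blast
    have fx: "f x = u *\<^sub>R f a + v *\<^sub>R f b + w *\<^sub>R f c"
      and fy: "f y = u' *\<^sub>R f a + v' *\<^sub>R f b + w' *\<^sub>R f c'"
      using affine_map_on_convex_comb[OF aff(1)] affine_map_on_convex_comb[OF aff(2)] x y'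
      by simp_all
    have eq: "w * orient (f a) (f b) (f c) = w' * orient (f a) (f b) (f c')"
      using orient_convex_comb(3)[OF x(4), of "f a" "f b" "f c"]
        orient_convex_comb(3)[OF y'(4), of "f a" "f b" "f c'"] \<open>f x = f y\<close> fx fy by metis
    have "w = 0"
    proof (rule ccontr)
      assume "w \<noteq> 0"
      then have "0 < w * (orient (f a) (f b) (f c))\<^sup>2" using x(3) nz(1) by simp
      also have "\<dots> = w' * (orient (f a) (f b) (f c) * orient (f a) (f b) (f c'))"
        using eq by (simp add: power2_eq_square)
      also have "\<dots> \<le> 0" using y'(3) opp False by (simp add: mult_nonneg_nonpos)
      finally show False by simp
    qed
    then have "x = u *\<^sub>R a + v *\<^sub>R b + 0 *\<^sub>R c'" "u + v + 0 = 1" using x by simp_all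
    then have "x \<in> convex hull {a, b, c'}"
      unfolding convex_hull_3 using x(1,2) by blast
    then show ?thesis using same[OF aff(2) nz(2) _ y \<open>f x = f y\<close>] by simp
  qed
  show ?thesis
  proof (rule inj_onI)
    fix x y
    assume "x \<in> convex hull {a, b, c} \<union> convex hull {a, b, c'}"
      "y \<in> convex hull {a, b, c} \<union> convex hull {a, b, c'}" "f x = f y"
    then show "x = y"
      using same[OF aff(1) nz(1)] same[OF aff(2) nz(2)] cross[of x y] cross[of y x] by auto
  qed
qed

text \<open>A point close to the midpoint of \<open>ab\<close> and on the segment towards \<open>c'\<close> has the same image
  as a point of the triangle \<open>abc\<close>.\<close>

lemma not_inj_on_adjacent_triangles:
  assumes aff: "affine_map_on f (convex hull {a, b, c})" "affine_map_on f (convex hull {a, b, c'})"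
    and c': "f c' = \<alpha> *\<^sub>R f a + \<beta> *\<^sub>R f b + \<gamma> *\<^sub>R f c" "\<alpha> + \<beta> + \<gamma> = 1" "\<gamma> \<ge> 0"
    and ne: "\<gamma> * orient a b c \<noteq> orient a b c'"
  shows "\<not> inj_on f (convex hull {a, b, c} \<union> convex hull {a, b, c'})"
proof
  assume inj: "inj_on f (convex hull {a, b, c} \<union> convex hull {a, b, c'})"
  \<comment> \<open>With this \<open>e\<close>, the number \<open>(1 - e) / 2\<close> equals
    \<open>e * (\<bar>\<alpha>\<bar> + \<bar>\<beta>\<bar>)\<close>, which keeps \<open>u\<close>
    and \<open>v\<close> nonnegative. They arise by inserting the expansion of \<open>f c'\<close>
    into the image of the point \<open>y\<close> at parameter \<open>e\<close> on the segment from
    the midpoint of \<open>ab\<close> to \<open>c'\<close>.\<close>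
  define e where "e = 1 / (1 + 2 * \<bar>\<alpha>\<bar> + 2 * \<bar>\<beta>\<bar>)"
  have e: "e > 0" "e \<le> 1" "e * (1 + 2 * \<bar>\<alpha>\<bar> + 2 * \<bar>\<beta>\<bar>) = 1" by (simp_all add: e_def field_simps)
  define u v where "u = (1 - e) / 2 + e * \<alpha>" and "v = (1 - e) / 2 + e * \<beta>"
  have bd: "- \<bar>\<alpha>\<bar> * e \<le> \<alpha> * e" "- \<bar>\<beta>\<bar> * e \<le> \<beta> * e" "\<bar>\<alpha>\<bar> * e \<ge> 0" "\<bar>\<beta>\<bar> * e \<ge> 0"
    using e(1) mult_right_mono[of "- \<bar>\<alpha>\<bar>" \<alpha> e] mult_right_mono[of "- \<bar>\<beta>\<bar>" \<beta> e] by auto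
  have u: "u \<ge> 0" and v: "v \<ge> 0"
  proof -
    define p q where "p = \<bar>\<alpha>\<bar> * e" and "q = \<bar>\<beta>\<bar> * e"
    have "e + 2 * p + 2 * q = 1" using e(3) by (simp add: p_def q_def algebra_simps)
    moreover have "- p \<le> \<alpha> * e" "- q \<le> \<beta> * e" "p \<ge> 0" "q \<ge> 0" using bd by (simp_all add: p_def q_def)
    moreover have "u = (1 - e) / 2 + \<alpha> * e" "v = (1 - e) / 2 + \<beta> * e" by (simp_all add: u_def v_def)
    ultimately have "u \<ge> 0 \<and> v \<ge> 0" by argo
    then show "u \<ge> 0" "v \<ge> 0" by simp_all
  qed
  have sum: "u + v + e * \<gamma> = 1" "(1 - e) / 2 + (1 - e) / 2 + e = 1"
  proof -
    have "u + v + e * \<gamma> = (1 - e) + e * (\<alpha> + \<beta> + \<gamma>)"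
      by (simp add: u_def v_def field_simps)
    then show "u + v + e * \<gamma> = 1" by (simp add: c'(2))
  qed (simp add: field_simps)
  define x where "x = u *\<^sub>R a + v *\<^sub>R b + (e * \<gamma>) *\<^sub>R c"
  define y where "y = ((1 - e) / 2) *\<^sub>R a + ((1 - e) / 2) *\<^sub>R b + e *\<^sub>R c'"
  have fx: "f x = u *\<^sub>R f a + v *\<^sub>R f b + (e * \<gamma>) *\<^sub>R f c"
    unfolding x_def using affine_map_on_convex_comb[OF aff(1) u v _ sum(1)] e c' by simp
  have fy: "f y = ((1 - e) / 2) *\<^sub>R f a + ((1 - e) / 2) *\<^sub>R f b + e *\<^sub>R f c'"
    unfolding y_def using affine_map_on_convex_comb[OF aff(2) _ _ _ sum(2)] e by simp
  have "f x = f y"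
    unfolding fx fy c' u_def v_def by (simp add: algebra_simps)
  moreover have "x \<in> convex hull {a, b, c}" "y \<in> convex hull {a, b, c'}"
    unfolding convex_hull_3 x_def y_def mem_Collect_eq
     apply (rule exI[of _ u], rule exI[of _ v], rule exI[of _ "e * \<gamma>"])
    using u v sum e c' apply simp
    apply (rule exI[of _ "(1 - e) / 2"], rule exI[of _ "(1 - e) / 2"], rule exI[of _ e])
    using sum e by simp
  ultimately have "x = y" using inj by (auto dest: inj_onD)
  \<comment> \<open>The signed areas over \<open>ab\<close> separate \<open>x\<close> from
    \<open>y\<close>, by the assumption \<open>ne\<close>.\<close>
  moreover have "orient a b x = e * (\<gamma> * orient a b c)" "orient a b y = e * orient a b c'"
    using orient_convex_comb(3)[OF sum(1)] orient_convex_comb(3)[OF sum(2)]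
    by (simp_all add: x_def y_def)
  ultimately show False using ne e(1) by simp
qed

text \<open>The number \<open>\<gamma>\<close> is the coordinate of \<open>f c'\<close> at
  \<open>f c\<close>. If it were nonnegative, \<open>f\<close> would fold the second triangle along
  the edge onto the side of the first one, or collapse it onto the line of the edge.\<close>

lemma orient_pos_adjacent:
  assumes aff: "affine_map_on f (convex hull {a, b, c})" "affine_map_on f (convex hull {a, b, c'})"
    and inj: "inj_on f (convex hull {a, b, c} \<union> convex hull {a, b, c'})"
    and opp: "orient a b c * orient a b c' < 0"
    and pos: "orient a b c * orient (f a) (f b) (f c) > 0"
  shows "orient a b c' * orient (f a) (f b) (f c') > 0"
proof -
  have nz: "orient (f a) (f b) (f c) \<noteq> 0" using pos by auto
  define \<gamma> where "\<gamma> = orient (f a) (f b) (f c') / orient (f a) (f b) (f c)"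
  have "\<gamma> < 0"
  proof (rule ccontr)
    assume "\<not> \<gamma> < 0"
    then have "\<gamma> \<ge> 0" by simp
    then have "\<gamma> * (orient a b c * orient a b c) \<ge> 0" by simp
    moreover have "\<gamma> * (orient a b c * orient a b c) = orient a b c * (\<gamma> * orient a b c)" by simp
    ultimately have "\<gamma> * orient a b c \<noteq> orient a b c'" using opp by auto
    then show False
      using not_inj_on_adjacent_triangles[OF aff _ _ \<open>\<gamma> \<ge> 0\<close>] inj
        orient_barycentric[OF nz, of "f c'"] unfolding \<gamma>_def by metis
  qed
  moreover have "orient (f a) (f b) (f c') = \<gamma> * orient (f a) (f b) (f c)"
    using nz by (simp add: \<gamma>_def)
  ultimately show ?thesis
    using opp pos by (auto simp: zero_less_mult_iff mult_less_0_iff)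
qed

text \<open>It remains to exclude that \<open>f c\<close> lies on the line through \<open>a\<close>
  and \<open>b\<close>. That is non-injectivity of the adjacent pair with \<open>c' = c\<close> and
  \<open>\<gamma> = 0\<close>.\<close>

lemma orient_pos_fixed_edge:
  assumes aff: "affine_map_on f (convex hull {a, b, c})"
    and inj: "inj_on f (convex hull {a, b, c})"
    and nz: "orient a b c \<noteq> 0" and fixed: "f a = a" "f b = b"
    and nonneg: "orient a b c * orient a b (f c) \<ge> 0"
  shows "orient a b c * orient (f a) (f b) (f c) > 0"
proof -
  have "orient a b (f c) \<noteq> 0"
  proof
    assume 0: "orient a b (f c) = 0"
    have "f c = (orient (f c) b c / orient a b c) *\<^sub>R f a + (orient a (f c) c / orient a b c) *\<^sub>R f b + 0 *\<^sub>R f c"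
      "orient (f c) b c / orient a b c + orient a (f c) c / orient a b c + 0 = 1"
      using orient_barycentric[OF nz, of "f c"] by (simp_all add: fixed 0)
    then show False
      using not_inj_on_adjacent_triangles[OF aff aff, of _ _ 0] inj nz by simp
  qed
  then show ?thesis using nonneg nz by (simp add: fixed order_less_le)
qed

section \<open>Local injectivity away from the vertices\<close>

text \<open>In the interior of the edge the coordinates at \<open>a\<close> and \<open>b\<close> are
  positive and stay so nearby; only the side of the line through \<open>a\<close> and
  \<open>b\<close> then decides membership.\<close>

lemma near_edge_in_triangle:
  assumes nz: "orient a b c \<noteq> 0" and uv: "0 < u" "0 < v" "u + v = 1"
  shows "\<exists>N. open N \<and> u *\<^sub>R a + v *\<^sub>R b \<in> N \<and>
    (\<forall>z\<in>N. orient a b c * orient a b z \<ge> 0 \<longrightarrow> z \<in> convex hull {a, b, c})"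
proof (intro exI conjI ballI impI)
  let ?N = "{z. 0 < orient a b c * orient z b c} \<inter> {z. 0 < orient a b c * orient a z c}"
  show "open ?N" by (intro open_Int open_Collect_less continuous_intros)
  have "u + v + 0 = 1" using uv by simp
  from orient_convex_comb[OF this, of a b c] show "u *\<^sub>R a + v *\<^sub>R b \<in> ?N"
    using nz uv by (simp add: mult.left_commute[of "orient a b c"] flip: power2_eq_square)
  show "z \<in> convex hull {a, b, c}" if "z \<in> ?N" "orient a b c * orient a b z \<ge> 0" for z
    using that nz by (intro in_triangle_if_orient) auto
qed

text \<open>Near the point, the two triangles at an inner edge cover everything, while at an edge
  with \<open>S\<close> on one side a single triangle covers the part in \<open>S\<close>.\<close>

lemma locally_inj_at_edge:
  assumes aff: "affine_map_on f (convex hull {a, b, c})"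
    and pos: "orient a b c * orient (f a) (f b) (f c) > 0"
    and uv: "0 < u" "0 < v" "u + v = 1"
    and edge: "(\<exists>c'. affine_map_on f (convex hull {a, b, c'}) \<and> orient a b c * orient a b c' < 0 \<and>
        orient a b c' * orient (f a) (f b) (f c') > 0) \<or>
      (\<forall>z\<in>S. orient a b c * orient a b z \<ge> 0)"
  shows "\<exists>N. open N \<and> u *\<^sub>R a + v *\<^sub>R b \<in> N \<and> inj_on f (N \<inter> S)"
proof -
  have nz: "orient a b c \<noteq> 0" "orient (f a) (f b) (f c) \<noteq> 0" using pos by auto
  obtain N where N: "open N" "u *\<^sub>R a + v *\<^sub>R b \<in> N"
    "\<And>z. z \<in> N \<Longrightarrow> orient a b c * orient a b z \<ge> 0 \<Longrightarrow> z \<in> convex hull {a, b, c}"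
    using near_edge_in_triangle[OF nz(1) uv] by blast
  from edge show ?thesis
  proof (elim disjE exE conjE)
    fix c' assume c': "affine_map_on f (convex hull {a, b, c'})" "orient a b c * orient a b c' < 0"
      "orient a b c' * orient (f a) (f b) (f c') > 0"
    have nz': "orient a b c' \<noteq> 0" "orient (f a) (f b) (f c') \<noteq> 0" using c' by auto
    obtain N' where N': "open N'" "u *\<^sub>R a + v *\<^sub>R b \<in> N'"
      "\<And>z. z \<in> N' \<Longrightarrow> orient a b c' * orient a b z \<ge> 0 \<Longrightarrow> z \<in> convex hull {a, b, c'}"
      using near_edge_in_triangle[OF nz'(1) uv] by blast
    have "z \<in> convex hull {a, b, c} \<union> convex hull {a, b, c'}" if "z \<in> N \<inter> N'" for z
    proof (cases "orient a b c * orient a b z \<ge> 0")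
      case True
      then show ?thesis using N(3) that by blast
    next
      case False
      then have "orient a b c' * orient a b z \<ge> 0"
        using c'(2) by (auto simp: mult_less_0_iff zero_le_mult_iff not_le)
      then show ?thesis using N'(3) that by blast
    qed
    moreover have "orient (f a) (f b) (f c) * orient (f a) (f b) (f c') < 0"
      using pos c'(2,3) by (auto simp: mult_less_0_iff zero_less_mult_iff)
    then have "inj_on f (convex hull {a, b, c} \<union> convex hull {a, b, c'})"
      using aff c'(1) nz(2) nz'(2) by (intro inj_on_adjacent_triangles) auto
    ultimately have "inj_on f (N \<inter> N' \<inter> S)" by (meson IntE inj_on_subset subsetI)
    then show ?thesis using N N' by (intro exI[of _ "N \<inter> N'"]) auto
  next
    assume "\<forall>z\<in>S. orient a b c * orient a b z \<ge> 0"
    then have "N \<inter> S \<subseteq> convex hull {a, b, c}" using N(3) by blast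
    moreover have "inj_on f (convex hull {a, b, c})"
      using inj_on_adjacent_triangles[OF aff aff nz(2) nz(2)] by simp
    ultimately have "inj_on f (N \<inter> S)" by (rule inj_on_subset[rotated])
    then show ?thesis using N by blast
  qed
qed

text \<open>On either side of the line through \<open>a\<close> and \<open>b\<close> there is a face with edge \<open>ab\<close>, unless no
  point of \<open>S\<close> lies strictly on that side.\<close>

definition edge_ok :: "complex set set \<Rightarrow> complex set \<Rightarrow> complex \<Rightarrow> complex \<Rightarrow> bool" where
  "edge_ok F S a b \<longleftrightarrow>
     ((\<exists>c. convex hull {a, b, c} \<in> F \<and> orient a b c > 0) \<or> (\<forall>z\<in>S. orient a b z \<le> 0)) \<and>
     ((\<exists>c. convex hull {a, b, c} \<in> F \<and> orient a b c < 0) \<or> (\<forall>z\<in>S. orient a b z \<ge> 0))"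

lemma edge_ok_commute: "edge_ok F S b a = edge_ok F S a b"
proof -
  have "orient b a c = - orient a b c" for c by (simp add: orient_def algebra_simps)
  then show ?thesis unfolding edge_ok_def by (auto simp: insert_commute)
qed

lemma edge_ok_opposite:
  assumes "edge_ok F S a b" "orient a b c \<noteq> 0"
  shows "(\<exists>c'. convex hull {a, b, c'} \<in> F \<and> orient a b c * orient a b c' < 0) \<or>
    (\<forall>z\<in>S. orient a b c * orient a b z \<ge> 0)"
proof (cases "orient a b c > 0")
  case True
  then have "orient a b c * t \<ge> 0 \<longleftrightarrow> t \<ge> 0" "orient a b c * t < 0 \<longleftrightarrow> t < 0" for t
    by (auto simp: zero_le_mult_iff mult_less_0_iff)
  then show ?thesis using assms(1) unfolding edge_ok_def by simp
next
  case False
  then have "orient a b c < 0" using assms(2) by simp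
  then have "orient a b c * t \<ge> 0 \<longleftrightarrow> t \<le> 0" "orient a b c * t < 0 \<longleftrightarrow> t > 0" for t
    by (auto simp: zero_le_mult_iff mult_less_0_iff)
  then show ?thesis using assms(1) unfolding edge_ok_def by simp
qed

lemma locally_inj_in_face:
  assumes F: "convex hull {a, b, c} \<in> F" "\<And>T. T \<in> F \<Longrightarrow> affine_map_on f T"
    and pos: "\<And>a b c. convex hull {a, b, c} \<in> F \<Longrightarrow> orient a b c \<noteq> 0 \<Longrightarrow>
      orient a b c * orient (f a) (f b) (f c) > 0"
    and nz: "orient a b c \<noteq> 0"
    and edges: "edge_ok F S a b" "edge_ok F S b c" "edge_ok F S c a"
    and x: "x \<in> convex hull {a, b, c}" "x \<notin> {a, b, c}"
  shows "\<exists>N. open N \<and> x \<in> N \<and> inj_on f (N \<inter> S)"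
proof -
  have at_edge: "\<exists>N. open N \<and> u *\<^sub>R a + v *\<^sub>R b \<in> N \<and> inj_on f (N \<inter> S)"
    if "convex hull {a, b, c} \<in> F" "orient a b c \<noteq> 0" "edge_ok F S a b" "0 < u" "0 < v" "u + v = 1"
    for a b c u v
  proof (rule locally_inj_at_edge[OF F(2)[OF that(1)] pos[OF that(1,2)] that(4-6)])
    show "(\<exists>c'. affine_map_on f (convex hull {a, b, c'}) \<and> orient a b c * orient a b c' < 0 \<and>
        orient a b c' * orient (f a) (f b) (f c') > 0) \<or> (\<forall>z\<in>S. orient a b c * orient a b z \<ge> 0)"
      using edge_ok_opposite[OF that(3,2)] F(2) pos by (metis less_irrefl mult_zero_right)
  qed
  obtain u v w where uvw: "0 \<le> u" "0 \<le> v" "0 \<le> w" "u + v + w = 1"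
    "x = u *\<^sub>R a + v *\<^sub>R b + w *\<^sub>R c"
    using x(1) unfolding convex_hull_3 by blast
  have "u \<noteq> 1 \<or> v \<noteq> 0 \<or> w \<noteq> 0" "u \<noteq> 0 \<or> v \<noteq> 1 \<or> w \<noteq> 0" "u \<noteq> 0 \<or> v \<noteq> 0 \<or> w \<noteq> 1"
    using x(2) uvw(5) by auto
  \<comment> \<open>At most one coordinate vanishes, as \<open>x\<close> is not a vertex: it is
    inside the triangle or inside one of the edges.\<close>
  then consider "u > 0" "v > 0" "w > 0" | "w = 0" "u > 0" "v > 0" | "u = 0" "v > 0" "w > 0"
    | "v = 0" "w > 0" "u > 0"
    using uvw by argo
  then show ?thesis
  proof cases
    case 1
    let ?N = "{z. 0 < orient a b c * orient z b c} \<inter> {z. 0 < orient a b c * orient a z c}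
      \<inter> {z. 0 < orient a b c * orient a b z}"
    have "open ?N" by (intro open_Int open_Collect_less continuous_intros)
    moreover have "x \<in> ?N"
      using orient_convex_comb[OF uvw(4), of a b c] nz 1 uvw(5)
      by (simp add: mult.left_commute[of "orient a b c"] flip: power2_eq_square)
    moreover have "?N \<subseteq> convex hull {a, b, c}"
      using nz by (auto intro!: in_triangle_if_orient)
    moreover have "orient (f a) (f b) (f c) \<noteq> 0" using pos[OF F(1) nz] by auto
    then have "inj_on f (convex hull {a, b, c})"
      using inj_on_adjacent_triangles[of f a b c c] F by auto
    ultimately show ?thesis by (meson inf_le1 inj_on_subset order_trans)
  next
    case 2
    then show ?thesis using at_edge[of a b c u v] F(1) nz edges(1) uvw by simp
  next
    case 3
    moreover have "convex hull {b, c, a} \<in> F" using F(1) by (simp add: insert_commute)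
    ultimately show ?thesis using at_edge[of b c a v w] nz edges(2) uvw
      by (simp add: orient_rotate)
  next
    case 4
    moreover have "convex hull {c, a, b} \<in> F" using F(1) by (simp add: insert_commute)
    ultimately show ?thesis using at_edge[of c a b w u] nz edges(3) uvw
      by (simp add: orient_rotate[symmetric, of c] add.commute)
  qed
qed

section \<open>The triangulated square\<close>

lemma in_Omega_iff: "z \<in> Omega \<longleftrightarrow> -1 \<le> Re z \<and> Re z \<le> 1 \<and> -1 \<le> Im z \<and> Im z \<le> 1"
  by (auto simp: Omega_def in_cbox_complex_iff)

lemma in_frontier_Omega_iff:
  "z \<in> frontier Omega \<longleftrightarrow> z \<in> Omega \<and> (\<bar>Re z\<bar> = 1 \<or> \<bar>Im z\<bar> = 1)"
proof -
  have "frontier Omega = Omega - box (Complex (-1) (-1)) (Complex 1 1)"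
    unfolding Omega_def frontier_def by simp
  then show ?thesis by (auto simp: in_Omega_iff in_box_complex_iff)
qed

section \<open>Grid coordinates\<close>

text \<open>Extends \<open>grid_vertex\<close> to real indices, so that every point of the square
  gets coordinates in which the vertices are integral.\<close>

definition grid_point :: "nat \<Rightarrow> nat \<Rightarrow> real \<Rightarrow> real \<Rightarrow> complex" where
  "grid_point H W x y = Complex (2 * x / (real H - 1) - 1) (2 * y / (real W - 1) - 1)"

lemma grid_vertex_eq: "grid_vertex H W i j = grid_point H W (real i) (real j)"
  by (simp add: grid_vertex_def grid_point_def)

context
  fixes H W :: nat
begin

abbreviation gv :: "nat \<Rightarrow> nat \<Rightarrow> complex" where "gv \<equiv> grid_vertex H W"

lemma in_faces_if_in_cell:
  assumes "i < H - 1" "j < W - 1" "T \<in> cell_faces d H W i j"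
  shows "T \<in> faces d H W"
  using assms unfolding faces_def by blast

text \<open>Each face is listed with its horizontal edge first, on the bottom or the top of the
  cell; the choice of diagonal only affects the third vertex.\<close>

lemma cell_faces_diag:
  "cell_faces d H W i j = (if d i j
     then {convex hull {gv i j, gv (Suc i) j, gv (Suc i) (Suc j)},
           convex hull {gv i (Suc j), gv (Suc i) (Suc j), gv i j}}
     else {convex hull {gv i j, gv (Suc i) j, gv i (Suc j)},
           convex hull {gv i (Suc j), gv (Suc i) (Suc j), gv (Suc i) j}})"
  by (simp add: cell_faces_def Let_def insert_commute)

lemma finite_faces: "finite (faces d H W)"
  unfolding faces_def cell_faces_def Let_def by auto

definition vertices :: "complex set" where
  "vertices = (\<lambda>(i, j). gv i j) ` ({..<H} \<times> {..<W})"

lemma finite_vertices: "finite vertices"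
  by (simp add: vertices_def)

text \<open>The area of one grid rectangle, which is the factor between signed areas in the square
  and in grid coordinates.\<close>

definition cell_orient :: real where
  "cell_orient = 4 / ((real H - 1) * (real W - 1))"

context
  assumes HW: "H \<ge> 2" "W \<ge> 2"
begin

lemma cell_orient_pos: "cell_orient > 0"
  using HW by (simp add: cell_orient_def)

lemma orient_grid_point:
  "orient (grid_point H W a b) (grid_point H W a' b') (grid_point H W a'' b'') =
     cell_orient * ((a' - a) * (b'' - b) - (b' - b) * (a'' - a))"
proof -
  define p q where "p = 2 / (real H - 1)" and "q = 2 / (real W - 1)"
  have "grid_point H W x y = Complex (p * x - 1) (q * y - 1)" for x y
    by (simp add: grid_point_def p_def q_def)
  moreover have "cell_orient = p * q" by (simp add: cell_orient_def p_def q_def)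
  ultimately show ?thesis by (simp add: orient_def algebra_simps)
qed

lemma in_OmegaE:
  assumes "z \<in> Omega"
  obtains x y where "z = grid_point H W x y" "0 \<le> x" "x \<le> real (H - 1)" "0 \<le> y" "y \<le> real (W - 1)"
proof
  have *: "real H - 1 > 0" "real W - 1 > 0" using HW by auto
  let ?x = "(Re z + 1) * (real H - 1) / 2" and ?y = "(Im z + 1) * (real W - 1) / 2"
  show "z = grid_point H W ?x ?y"
    using * by (simp add: grid_point_def complex_eq_iff)
  have b: "0 \<le> Re z + 1" "Re z + 1 \<le> 2" "0 \<le> Im z + 1" "Im z + 1 \<le> 2"
    using assms by (auto simp: in_Omega_iff)
  show "0 \<le> ?x" "0 \<le> ?y" using b * by simp_all
  have "(Re z + 1) * (real H - 1) \<le> 2 * (real H - 1)" "(Im z + 1) * (real W - 1) \<le> 2 * (real W - 1)"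
    using b * by - (rule mult_right_mono; simp)+
  moreover have "real (H - 1) = real H - 1" "real (W - 1) = real W - 1" using HW by auto
  ultimately show "?x \<le> real (H - 1)" "?y \<le> real (W - 1)" by simp_all
qed

lemma grid_point_in_Omega:
  assumes "0 \<le> x" "x \<le> real (H - 1)" "0 \<le> y" "y \<le> real (W - 1)"
  shows "grid_point H W x y \<in> Omega"
proof -
  have "real (H - 1) = real H - 1" "real (W - 1) = real W - 1" using HW by auto
  then show ?thesis using assms HW by (auto simp: grid_point_def in_Omega_iff divide_le_eq)
qed

section \<open>The faces on both sides of an edge\<close>

text \<open>Above the edge lies the cell \<open>(i, j)\<close>, unless the edge is on the top side
  \<open>j = W - 1\<close>; below it lies the cell \<open>(i, j - 1)\<close>, unless
  \<open>j = 0\<close>.\<close>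

lemma edge_ok_horizontal:
  assumes i: "i < H - 1" and j: "j \<le> W - 1"
  shows "edge_ok (faces d H W) Omega (gv i j) (gv (Suc i) j)"
  unfolding edge_ok_def
proof (intro conjI)
  show "(\<exists>c. convex hull {gv i j, gv (Suc i) j, c} \<in> faces d H W \<and> orient (gv i j) (gv (Suc i) j) c > 0)
    \<or> (\<forall>z\<in>Omega. orient (gv i j) (gv (Suc i) j) z \<le> 0)"
  proof (cases "j = W - 1")
    case True
    have "orient (gv i j) (gv (Suc i) j) z \<le> 0" if "z \<in> Omega" for z
      using that cell_orient_pos True
      by (elim in_OmegaE) (simp add: grid_vertex_eq orient_grid_point mult_nonneg_nonpos)
    then show ?thesis by blast
  next
    case False
    then have "j < W - 1" using j by simp
    note in_faces_if_in_cell[OF i this, of _ d]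
    then have "convex hull {gv i j, gv (Suc i) j, if d i j then gv (Suc i) (Suc j) else gv i (Suc j)} \<in> faces d H W"
      by (simp add: cell_faces_diag)
    moreover have "orient (gv i j) (gv (Suc i) j) (if d i j then gv (Suc i) (Suc j) else gv i (Suc j)) > 0"
      using cell_orient_pos by (simp add: grid_vertex_eq orient_grid_point)
    ultimately show ?thesis by blast
  qed
  show "(\<exists>c. convex hull {gv i j, gv (Suc i) j, c} \<in> faces d H W \<and> orient (gv i j) (gv (Suc i) j) c < 0)
    \<or> (\<forall>z\<in>Omega. orient (gv i j) (gv (Suc i) j) z \<ge> 0)"
  proof (cases j)
    case 0
    have "orient (gv i j) (gv (Suc i) j) z \<ge> 0" if "z \<in> Omega" for z
      using that cell_orient_pos 0
      by (elim in_OmegaE) (simp add: grid_vertex_eq orient_grid_point)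
    then show ?thesis by blast
  next
    case (Suc k)
    then have "k < W - 1" using j by simp
    note in_faces_if_in_cell[OF i this, of _ d]
    then have "convex hull {gv i j, gv (Suc i) j, if d i k then gv i k else gv (Suc i) k} \<in> faces d H W"
      by (simp add: cell_faces_diag Suc)
    moreover have "orient (gv i j) (gv (Suc i) j) (if d i k then gv i k else gv (Suc i) k) < 0"
      using cell_orient_pos by (simp add: grid_vertex_eq orient_grid_point Suc)
    ultimately show ?thesis by blast
  qed
qed

text \<open>The edge runs upwards, so its negative side is on the right with cell
  \<open>(i, j)\<close>, and its positive side is on the left with cell
  \<open>(i - 1, j)\<close>.\<close>

lemma edge_ok_vertical:
  assumes i: "i \<le> H - 1" and j: "j < W - 1"
  shows "edge_ok (faces d H W) Omega (gv i j) (gv i (Suc j))"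
  unfolding edge_ok_def
proof (intro conjI)
  show "(\<exists>c. convex hull {gv i j, gv i (Suc j), c} \<in> faces d H W \<and> orient (gv i j) (gv i (Suc j)) c < 0)
    \<or> (\<forall>z\<in>Omega. orient (gv i j) (gv i (Suc j)) z \<ge> 0)"
  proof (cases "i = H - 1")
    case True
    have "orient (gv i j) (gv i (Suc j)) z \<ge> 0" if "z \<in> Omega" for z
      using that cell_orient_pos True
      by (elim in_OmegaE) (simp add: grid_vertex_eq orient_grid_point)
    then show ?thesis by blast
  next
    case False
    then have "i < H - 1" using i by simp
    note in_faces_if_in_cell[OF this j, of _ d]
    then have "convex hull {gv i j, gv i (Suc j), if d i j then gv (Suc i) (Suc j) else gv (Suc i) j} \<in> faces d H W"
      by (simp add: cell_faces_diag insert_commute)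
    moreover have "orient (gv i j) (gv i (Suc j)) (if d i j then gv (Suc i) (Suc j) else gv (Suc i) j) < 0"
      using cell_orient_pos by (simp add: grid_vertex_eq orient_grid_point)
    ultimately show ?thesis by blast
  qed
  show "(\<exists>c. convex hull {gv i j, gv i (Suc j), c} \<in> faces d H W \<and> orient (gv i j) (gv i (Suc j)) c > 0)
    \<or> (\<forall>z\<in>Omega. orient (gv i j) (gv i (Suc j)) z \<le> 0)"
  proof (cases i)
    case 0
    have "orient (gv i j) (gv i (Suc j)) z \<le> 0" if "z \<in> Omega" for z
      using that cell_orient_pos 0
      by (elim in_OmegaE) (simp add: grid_vertex_eq orient_grid_point)
    then show ?thesis by blast
  next
    case (Suc k)
    then have "k < H - 1" using i by simp
    note in_faces_if_in_cell[OF this j, of _ d]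
    then have "convex hull {gv i j, gv i (Suc j), if d k j then gv k j else gv k (Suc j)} \<in> faces d H W"
      by (simp add: cell_faces_diag Suc insert_commute)
    moreover have "orient (gv i j) (gv i (Suc j)) (if d k j then gv k j else gv k (Suc j)) > 0"
      using cell_orient_pos by (simp add: grid_vertex_eq orient_grid_point Suc)
    ultimately show ?thesis by blast
  qed
qed

lemma edge_ok_diagonal:
  assumes "i < H - 1" "j < W - 1"
  shows "d i j \<Longrightarrow> edge_ok (faces d H W) Omega (gv i j) (gv (Suc i) (Suc j))"
    and "\<not> d i j \<Longrightarrow> edge_ok (faces d H W) Omega (gv (Suc i) j) (gv i (Suc j))"
proof -
  assume d: "d i j"
  have "convex hull {gv i j, gv (Suc i) (Suc j), gv i (Suc j)} \<in> faces d H W"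
    "convex hull {gv i j, gv (Suc i) (Suc j), gv (Suc i) j} \<in> faces d H W"
    using d in_faces_if_in_cell[OF assms, of _ d] by (simp_all add: cell_faces_diag insert_commute)
  moreover have "orient (gv i j) (gv (Suc i) (Suc j)) (gv i (Suc j)) > 0"
    "orient (gv i j) (gv (Suc i) (Suc j)) (gv (Suc i) j) < 0"
    using cell_orient_pos by (simp_all add: grid_vertex_eq orient_grid_point)
  ultimately show "edge_ok (faces d H W) Omega (gv i j) (gv (Suc i) (Suc j))"
    unfolding edge_ok_def by blast
next
  assume d: "\<not> d i j"
  have "convex hull {gv (Suc i) j, gv i (Suc j), gv i j} \<in> faces d H W"
    "convex hull {gv (Suc i) j, gv i (Suc j), gv (Suc i) (Suc j)} \<in> faces d H W"
    using d in_faces_if_in_cell[OF assms, of _ d] by (simp_all add: cell_faces_diag insert_commute)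
  moreover have "orient (gv (Suc i) j) (gv i (Suc j)) (gv i j) > 0"
    "orient (gv (Suc i) j) (gv i (Suc j)) (gv (Suc i) (Suc j)) < 0"
    using cell_orient_pos by (simp_all add: grid_vertex_eq orient_grid_point)
  ultimately show "edge_ok (faces d H W) Omega (gv (Suc i) j) (gv i (Suc j))"
    unfolding edge_ok_def by blast
qed

lemma vertices_subset_Omega: "vertices \<subseteq> Omega"
  unfolding vertices_def by (auto simp: grid_vertex_eq intro!: grid_point_in_Omega)

lemma faceE:
  assumes "T \<in> faces d H W"
  obtains a b c where "T = convex hull {a, b, c}" "orient a b c \<noteq> 0" "{a, b, c} \<subseteq> vertices"
    "edge_ok (faces d H W) Omega a b" "edge_ok (faces d H W) Omega b c" "edge_ok (faces d H W) Omega c a"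
proof -
  obtain i j where ij: "i < H - 1" "j < W - 1" "T \<in> cell_faces d H W i j"
    using assms unfolding faces_def by blast
  have V: "gv i j \<in> vertices" "gv (Suc i) j \<in> vertices" "gv i (Suc j) \<in> vertices"
    "gv (Suc i) (Suc j) \<in> vertices"
    using ij by (auto simp: vertices_def)
  have e: "edge_ok (faces d H W) Omega (gv i j) (gv (Suc i) j)"
    "edge_ok (faces d H W) Omega (gv i (Suc j)) (gv (Suc i) (Suc j))"
    "edge_ok (faces d H W) Omega (gv i j) (gv i (Suc j))"
    "edge_ok (faces d H W) Omega (gv (Suc i) j) (gv (Suc i) (Suc j))"
    using ij by (auto intro!: edge_ok_horizontal edge_ok_vertical)
  note e' = e e[THEN edge_ok_commute[THEN iffD2]]
  note diag = edge_ok_diagonal[of i j d, OF ij(1,2)]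
  have c0: "cell_orient \<noteq> 0" using cell_orient_pos by simp
  from ij(3) show ?thesis
    unfolding cell_faces_diag
  proof (cases "d i j"; simp only: if_True if_False insert_iff empty_iff simp_thms; elim disjE)
    assume d: "d i j" and T: "T = convex hull {gv i j, gv (Suc i) j, gv (Suc i) (Suc j)}"
    show ?thesis
      using T e' diag(1)[OF d] diag(1)[OF d, THEN edge_ok_commute[THEN iffD2]] V c0
      by (intro that[of "gv i j" "gv (Suc i) j" "gv (Suc i) (Suc j)"]) (simp_all add: grid_vertex_eq orient_grid_point)
  next
    assume d: "d i j" and T: "T = convex hull {gv i (Suc j), gv (Suc i) (Suc j), gv i j}"
    show ?thesis
      using T e' diag(1)[OF d] diag(1)[OF d, THEN edge_ok_commute[THEN iffD2]] V c0
      by (intro that[of "gv i (Suc j)" "gv (Suc i) (Suc j)" "gv i j"]) (simp_all add: grid_vertex_eq orient_grid_point)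
  next
    assume d: "\<not> d i j" and T: "T = convex hull {gv i j, gv (Suc i) j, gv i (Suc j)}"
    show ?thesis
      using T e' diag(2)[OF d] diag(2)[OF d, THEN edge_ok_commute[THEN iffD2]] V c0
      by (intro that[of "gv i j" "gv (Suc i) j" "gv i (Suc j)"]) (simp_all add: grid_vertex_eq orient_grid_point)
  next
    assume d: "\<not> d i j" and T: "T = convex hull {gv i (Suc j), gv (Suc i) (Suc j), gv (Suc i) j}"
    show ?thesis
      using T e' diag(2)[OF d] diag(2)[OF d, THEN edge_ok_commute[THEN iffD2]] V c0
      by (intro that[of "gv i (Suc j)" "gv (Suc i) (Suc j)" "gv (Suc i) j"]) (simp_all add: grid_vertex_eq orient_grid_point)
  qed
qed

lemma face_subset_Omega: "T \<in> faces d H W \<Longrightarrow> T \<subseteq> Omega"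
proof (elim faceE)
  fix a b c assume "T = convex hull {a, b, c}" "{a, b, c} \<subseteq> vertices"
  moreover have "convex Omega" by (simp add: Omega_def)
  ultimately show "T \<subseteq> Omega" using vertices_subset_Omega by (metis hull_minimal order_trans)
qed

text \<open>Rounding down the grid coordinates finds the cell, and comparison with its diagonal
  finds the face.\<close>

lemma Omega_subset_faces: "Omega \<subseteq> \<Union> (faces d H W)"
proof
  have cell: "\<exists>i<n. real i \<le> x \<and> x \<le> real i + 1" if "0 \<le> x" "x \<le> real n" "n > 0" for x n
  \<comment> \<open>At the right end, rounding down would give the nonexistent cell
    \<open>n\<close>, so the last cell \<open>n - 1\<close> is taken.\<close>
  proof (cases "x = real n")
    case True
    then show ?thesis using that by (intro exI[of _ "n - 1"]) auto
  next
    case False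
    have "real (nat \<lfloor>x\<rfloor>) = of_int \<lfloor>x\<rfloor>" using that by simp
    then have "real (nat \<lfloor>x\<rfloor>) \<le> x" "x \<le> real (nat \<lfloor>x\<rfloor>) + 1" "nat \<lfloor>x\<rfloor> < n"
      using that False by linarith+
    then show ?thesis by blast
  qed
  fix z assume "z \<in> Omega"
  then obtain x y where z: "z = grid_point H W x y"
    and "0 \<le> x" "x \<le> real (H - 1)" "0 \<le> y" "y \<le> real (W - 1)"
    by (rule in_OmegaE)
  then obtain i j where ij: "i < H - 1" "j < W - 1"
    and x: "real i \<le> x" "x \<le> real i + 1" and y: "real j \<le> y" "y \<le> real j + 1"
    using cell[of x "H - 1"] cell[of y "W - 1"] HW by auto
  note o = grid_vertex_eq orient_grid_point z
  \<comment> \<open>Reduces each sign condition for membership in a triangle to an inequality in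
    grid coordinates.\<close>
  have k: "0 \<le> (cell_orient * s) * (cell_orient * t)" if "0 \<le> s * t" for s t
    using mult_nonneg_nonneg[OF mult_nonneg_nonneg[OF less_imp_le less_imp_le] that, OF cell_orient_pos cell_orient_pos]
    by (simp add: mult_ac)
  have c0: "cell_orient \<noteq> 0" using cell_orient_pos by simp
  have "\<exists>T\<in>cell_faces d H W i j. z \<in> T"
  proof (cases "d i j")
    case True
    show ?thesis
    proof (cases "y - real j \<le> x - real i")
      case le: True
      have "z \<in> convex hull {gv i j, gv (Suc i) j, gv (Suc i) (Suc j)}"
        using x y le c0 
        by (intro in_triangle_if_orient, simp_all only: o)
          (simp, (rule k, simp add: algebra_simps)+)
      then show ?thesis using True by (simp add: cell_faces_diag)
    next
      case False
      have "z \<in> convex hull {gv i (Suc j), gv (Suc i) (Suc j), gv i j}"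
        using x y False c0 
        by (intro in_triangle_if_orient, simp_all only: o)
          (simp, (rule k, simp add: algebra_simps)+)
      then show ?thesis using True by (simp add: cell_faces_diag)
    qed
  next
    case False
    show ?thesis
    proof (cases "(x - real i) + (y - real j) \<le> 1")
      case le: True
      have "z \<in> convex hull {gv i j, gv (Suc i) j, gv i (Suc j)}"
        using x y le c0 
        by (intro in_triangle_if_orient, simp_all only: o)
          (simp, (rule k, simp add: algebra_simps)+)
      then show ?thesis using False by (simp add: cell_faces_diag)
    next
      case gt: False
      have "z \<in> convex hull {gv i (Suc j), gv (Suc i) (Suc j), gv (Suc i) j}"
        using x y gt c0 
        by (intro in_triangle_if_orient, simp_all only: o)
          (simp, (rule k, simp add: algebra_simps)+)
      then show ?thesis using False by (simp add: cell_faces_diag)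
    qed
  qed
  then show "z \<in> \<Union> (faces d H W)" using in_faces_if_in_cell[OF ij] by blast
qed

end

end

section \<open>Orientation and bijectivity\<close>

context
  fixes H W :: nat and d :: "nat \<Rightarrow> nat \<Rightarrow> bool" and f :: "complex \<Rightarrow> complex"
  assumes HW: "H \<ge> 2" "W \<ge> 2" and BAM: "BAM_output d H W f"
begin

lemma f_Omega: "f \<in> Omega \<rightarrow> Omega" "continuous_on Omega f" "z \<in> frontier Omega \<Longrightarrow> f z = z"
  and f_affine: "T \<in> faces d H W \<Longrightarrow> affine_map_on f T"
  using BAM unfolding BAM_output_def by auto

text \<open>The topological criterion applies with the grid vertices as exceptional set. Fibres are
  finite because finitely many faces cover the square and \<open>f\<close> is injective on
  each.\<close>

lemma bij_if_orient_pos: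
  assumes pos: "\<And>a b c. convex hull {a, b, c} \<in> faces d H W \<Longrightarrow> orient a b c \<noteq> 0 \<Longrightarrow>
      orient a b c * orient (f a) (f b) (f c) > 0"
  shows "bij_betw f Omega Omega"
proof (rule bij_betw_if_locally_inj_fixing_frontier[where V = "vertices H W"])
  show "compact Omega" "convex Omega" by (simp_all add: Omega_def)
  show "interior Omega \<noteq> {}" by (simp add: Omega_def box_ne_empty Basis_complex_def)
  show "infinite (frontier Omega)"
  proof
    assume "finite (frontier Omega)"
    moreover have "(\<lambda>t. Complex t (-1)) ` {-1..1} \<subseteq> frontier Omega"
      by (auto simp: in_frontier_Omega_iff in_Omega_iff)
    ultimately have "finite ((\<lambda>t. Complex t (-1)) ` {-1..1})" by (rule rev_finite_subset)
    then show False 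
      by (subst (asm) finite_image_iff) (auto simp: inj_on_def infinite_Icc)
  qed
  have inj: "inj_on f T" if "T \<in> faces d H W" for T
    using that
  proof (rule faceE[OF HW])
    fix a b c assume T: "T = convex hull {a, b, c}" "orient a b c \<noteq> 0"
    then have "orient (f a) (f b) (f c) \<noteq> 0" using pos that by (metis less_irrefl mult_zero_right)
    then show ?thesis
      using inj_on_adjacent_triangles[of f a b c c] f_affine[OF that] T by simp
  qed
  show "finite {x \<in> Omega. f x = y}" for y
  proof (rule finite_subset)
    show "{x \<in> Omega. f x = y} \<subseteq> (\<Union>T\<in>faces d H W. {x \<in> T. f x = y})"
      using Omega_subset_faces[OF HW, of d] by blast
    have "finite {x \<in> T. f x = y}" if "T \<in> faces d H W" for T
    proof (rule finite_imageD)
      have "f ` {x \<in> T. f x = y} \<subseteq> {y}" by blast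
      then show "finite (f ` {x \<in> T. f x = y})" using finite_subset by blast
      show "inj_on f {x \<in> T. f x = y}" using inj[OF that] by (rule inj_on_subset) blast
    qed
    then show "finite (\<Union>T\<in>faces d H W. {x \<in> T. f x = y})"
      using finite_faces by blast
  qed
  show "\<exists>N. open N \<and> x \<in> N \<and> inj_on f (N \<inter> Omega)" if x: "x \<in> Omega - vertices H W" for x
  proof -
    obtain T where T: "T \<in> faces d H W" "x \<in> T" using x Omega_subset_faces[OF HW] by blast
    obtain a b c where "T = convex hull {a, b, c}" "orient a b c \<noteq> 0" "{a, b, c} \<subseteq> vertices H W"
      "edge_ok (faces d H W) Omega a b" "edge_ok (faces d H W) Omega b c" "edge_ok (faces d H W) Omega c a"
      using T(1) by (rule faceE[OF HW])
    then show ?thesis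
      using locally_inj_in_face[of a b c "faces d H W" f Omega x] T x f_affine pos by blast
  qed
qed (use f_Omega finite_vertices in auto)

text \<open>Induction up the column \<open>i\<close> of cells, which starts at a fixed edge on the
  bottom side: each step crosses the diagonal of a cell and then the horizontal edge to the next
  cell.\<close>

lemma orient_pos_if_inj:
  assumes inj: "inj_on f Omega" and T: "T \<in> faces d H W"
  shows "\<exists>a b c. T = convex hull {a, b, c} \<and> orient a b c * orient (f a) (f b) (f c) > 0"
proof -
  define pos where "pos a b c \<longleftrightarrow> orient a b c * orient (f a) (f b) (f c) > 0" for a b c
  \<comment> \<open>A permutation of the vertices changes the signs of both factors alike, so
    \<open>pos\<close> is a property of the face together with \<open>f\<close>.\<close>
  have pos_commute: "pos b c a = pos a b c" "pos a c b = pos a b c" for a b c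
    by (simp_all add: pos_def orient_rotate[of b c a] orient_rotate[of "f b" "f c" "f a"]
        orient_swap[of a c b] orient_swap[of "f a" "f c" "f b"])
  have adj: "pos a b c'"
    if F: "convex hull {a, b, c} \<in> faces d H W" "convex hull {a, b, c'} \<in> faces d H W"
      and "orient a b c * orient a b c' < 0" "pos a b c" for a b c c'
  proof -
    have "inj_on f (convex hull {a, b, c} \<union> convex hull {a, b, c'})"
      using inj face_subset_Omega[OF HW F(1)] face_subset_Omega[OF HW F(2)]
      by (meson inj_on_subset sup_least)
    then show ?thesis
      using that f_affine orient_pos_adjacent unfolding pos_def by blast
  qed
  let ?v = "grid_vertex H W"
  obtain i j where ij: "i < H - 1" "j < W - 1" "T \<in> cell_faces d H W i j"
    using T unfolding faces_def by blast
  \<comment> \<open>\<open>B j\<close> and \<open>U j\<close> are the apexes of the faces on the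
    bottom and on the top edge of the cell \<open>(i, j)\<close>.\<close>
  define B where "B j = (if d i j then ?v (Suc i) (Suc j) else ?v i (Suc j))" for j
  define U where "U j = (if d i j then ?v i j else ?v (Suc i) j)" for j
  have cell: "cell_faces d H W i j = {convex hull {?v i j, ?v (Suc i) j, B j},
      convex hull {?v i (Suc j), ?v (Suc i) (Suc j), U j}}" for j
    by (simp add: cell_faces_diag B_def U_def)
  have F: "convex hull {?v i j, ?v (Suc i) j, B j} \<in> faces d H W"
    "convex hull {?v i (Suc j), ?v (Suc i) (Suc j), U j} \<in> faces d H W" if "j < W - 1" for j
    using in_faces_if_in_cell[OF ij(1) that, of _ d] by (auto simp: cell)
  note cpos = cell_orient_pos[OF HW]
  note orient_gp = orient_grid_point[OF HW]
  have oB: "orient (?v i j) (?v (Suc i) j) (B j) > 0"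
    and oU: "orient (?v i (Suc j)) (?v (Suc i) (Suc j)) (U j) < 0" for j
    using cpos by (simp_all add: B_def U_def grid_vertex_eq orient_gp)
  have diag: "pos (?v i (Suc j)) (?v (Suc i) (Suc j)) (U j)"
    if j: "j < W - 1" and p: "pos (?v i j) (?v (Suc i) j) (B j)" for j
  proof (cases "d i j")
    case True
    have "orient (?v i j) (?v (Suc i) (Suc j)) (?v (Suc i) j) *
        orient (?v i j) (?v (Suc i) (Suc j)) (?v i (Suc j)) < 0"
      using cpos by (simp add: grid_vertex_eq orient_gp)
    moreover have "pos (?v i j) (?v (Suc i) (Suc j)) (?v (Suc i) j)"
      using p True by (simp add: B_def pos_commute(2)[of "?v i j" "?v (Suc i) (Suc j)"])
    moreover have "convex hull {?v i j, ?v (Suc i) (Suc j), ?v (Suc i) j} \<in> faces d H W"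
      "convex hull {?v i j, ?v (Suc i) (Suc j), ?v i (Suc j)} \<in> faces d H W"
      using F[OF j] True by (simp_all add: B_def U_def insert_commute)
    ultimately have "pos (?v i j) (?v (Suc i) (Suc j)) (?v i (Suc j))" using adj by blast
    then show ?thesis
      using True pos_commute(1)[where a = "?v i j" and b = "?v i (Suc j)"]
        pos_commute(2)[where a = "?v i j" and b = "?v i (Suc j)"] by (simp add: U_def)
  next
    case False
    have "orient (?v (Suc i) j) (?v i (Suc j)) (?v i j) *
        orient (?v (Suc i) j) (?v i (Suc j)) (?v (Suc i) (Suc j)) < 0"
      using cpos by (simp add: grid_vertex_eq orient_gp)
    moreover have "pos (?v (Suc i) j) (?v i (Suc j)) (?v i j)"
      using p False pos_commute(1)[where a = "?v i j"] by (simp add: B_def)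
    moreover have "convex hull {?v (Suc i) j, ?v i (Suc j), ?v i j} \<in> faces d H W"
      "convex hull {?v (Suc i) j, ?v i (Suc j), ?v (Suc i) (Suc j)} \<in> faces d H W"
      using F[OF j] False by (simp_all add: B_def U_def insert_commute)
    ultimately have "pos (?v (Suc i) j) (?v i (Suc j)) (?v (Suc i) (Suc j))" using adj by blast
    then show ?thesis
      using False pos_commute(1)[where a = "?v (Suc i) j"] by (simp add: U_def)
  qed
  have bottom: "pos (?v i j) (?v (Suc i) j) (B j)" if "j < W - 1" for j
    using that
  proof (induction j)
    case 0
    have le: "real (Suc i) \<le> real (H - 1)" using ij(1) by simp
    have Om: "?v i 0 \<in> Omega" "?v (Suc i) 0 \<in> Omega"
      unfolding grid_vertex_eq using le by (intro grid_point_in_Omega[OF HW]; simp)+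
    then have fx: "f (?v i 0) = ?v i 0" "f (?v (Suc i) 0) = ?v (Suc i) 0"
      by (auto intro!: f_Omega(3) simp: in_frontier_Omega_iff grid_vertex_def)
    have "B 0 \<in> Omega"
      using face_subset_Omega[OF HW F(1)[OF 0]] by (meson hull_inc insertCI subsetD)
    then have "f (B 0) \<in> Omega" using f_Omega(1) by blast
    \<comment> \<open>The whole square lies on or above the line of its bottom side, so the image of
      the apex cannot lie below it.\<close>
    then have "orient (?v i 0) (?v (Suc i) 0) (f (B 0)) \<ge> 0"
      using cpos by (elim in_OmegaE[OF HW]) (simp add: grid_vertex_eq orient_gp)
    moreover have "inj_on f (convex hull {?v i 0, ?v (Suc i) 0, B 0})"
      using inj face_subset_Omega[OF HW F(1)[OF 0]] by (rule inj_on_subset)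
    ultimately show ?case
      unfolding pos_def using f_affine[OF F(1)[OF 0]] oB[of 0] fx
      by (intro orient_pos_fixed_edge) auto
  next
    case (Suc j)
    then have j: "j < W - 1" by simp
    show ?case
      \<comment> \<open>The top edge of cell \<open>j\<close> is the bottom edge of cell
        \<open>Suc j\<close>, with the apexes \<open>U j\<close> and \<open>B (Suc j)\<close> on
        opposite sides.\<close>
      using adj[OF F(2)[OF j] F(1)[OF Suc.prems] mult_neg_pos[OF oU oB] diag[OF j Suc.IH[OF j]]] .
  qed
  show ?thesis
    using ij(3) bottom[OF ij(2)] diag[OF ij(2) bottom[OF ij(2)]] unfolding cell pos_def by blast
qed

end

theorem theorem1:
  fixes H W :: nat
    and d :: "nat \<Rightarrow> nat \<Rightarrow> bool"
    and f :: "complex \<Rightarrow> complex"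
  assumes "H \<ge> 2" and "W \<ge> 2"
    and "BAM_output d H W f"
  shows "bij_betw f Omega Omega \<longleftrightarrow>
           beltrami_well_defined f (faces d H W) \<and>
           (\<forall>T\<in>faces d H W. cmod (beltrami f T) < 1)"
proof -
  have "bij_betw f Omega Omega \<longleftrightarrow>
      (\<forall>T\<in>faces d H W. face_dz f T \<noteq> 0 \<and> cmod (beltrami f T) < 1)"
  proof
    assume "bij_betw f Omega Omega"
    then have inj: "inj_on f Omega" by (rule bij_betw_imp_inj_on)
    show "\<forall>T\<in>faces d H W. face_dz f T \<noteq> 0 \<and> cmod (beltrami f T) < 1"
    proof
      fix T assume T: "T \<in> faces d H W"
      obtain a b c where abc: "T = convex hull {a, b, c}"
        "orient a b c * orient (f a) (f b) (f c) > 0"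
        using orient_pos_if_inj[OF assms inj T] by blast
      then have "orient a b c \<noteq> 0" by auto
      then show "face_dz f T \<noteq> 0 \<and> cmod (beltrami f T) < 1"
        using beltrami_less_1_iff_orient f_affine[OF assms T] abc by blast
    qed
  next
    assume R: "\<forall>T\<in>faces d H W. face_dz f T \<noteq> 0 \<and> cmod (beltrami f T) < 1"
    show "bij_betw f Omega Omega"
    proof (rule bij_if_orient_pos[OF assms])
      fix a b c assume "convex hull {a, b, c} \<in> faces d H W" "orient a b c \<noteq> 0"
      then show "0 < orient a b c * orient (f a) (f b) (f c)"
        using beltrami_less_1_iff_orient f_affine[OF assms] R by blast
    qed
  qed
  then show ?thesis unfolding beltrami_well_defined_def by blast
qed

end
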